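(* Assume that the Gram matrix $\mathcal{G}_A$ is invertible and Hermitian, that, if $m\geq 2$, $[\mathcal{G}_A]_{\sigma,m-1;\sigma' m}=[\mathcal{G}_A]_{\sigma m;\sigma',m-1}$ for all $\sigma,\sigma'\in\mathcal{S}$, and that $\mathcal{G}^{\min}_A$ is positive definite. Let $\Theta$ be a linear relation in $\mathbb{C}^d$, let $B_\Theta:=\{\widehat f\in B_{\max}\mid(\Gamma'_0\widehat f,\Gamma'_1\widehat f)\in\Theta\}$, and let $B_0:=\ker\Gamma'_0$. Let $P_{\mathfrak{H}_m}$ be the projection in $\mathcal{H}_A=\mathfrak{H}_m\dotplus\mathfrak{K}_A$ onto $\mathfrak{H}_m$ (along $\mathfrak{K}_A$). Then for $z\in\operatorname{res}B_0\cap\operatorname{res}B_\Theta$ the compressed resolvent of $B_\Theta$ is given (in the generalized sense) by $$P_{\mathfrak{H}_m}(B_\Theta-z)^{-1}|_{\mathfrak{H}_m}=(L-z)^{-1}+\sum_{\sigma\in\mathcal{S}}\big[(\Theta-M_{\Gamma'}(z))^{-1}\langle\varphi,(L-z)^{-1}\cdot\rangle\big]_\sigma\,(L-z)^{-1}h_{\sigma m},$$ where $M_{\Gamma'}(z)=q(z)+\mathcal{G}^{\min}_A(\hat\Delta-z)^{-1}$.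
   Context: Setting. $L$ is a lower semibounded self-adjoint operator in a Hilbert space $\mathfrak{H}_0$; scalar products are conjugate linear in the first factor; $\operatorname{res}$ denotes the resolvent set. Fix a model parameter $z_1\in\operatorname{res}L\cap\mathbb{R}$ and put $b_n(L):=(L-z_1)^n$. $(\mathfrak{H}_n)_{n\in\mathbb{Z}}$ is the scale of Hilbert spaces associated with $L$, with scalar products $\langle\cdot,\cdot\rangle_n:=\langle b_n(L)^{1/2}\cdot,b_n(L)^{1/2}\cdot\rangle_0$. $L$ acts from $\mathfrak{H}_{n+2}$ to $\mathfrak{H}_n$ for all $n$; as an operator in $\mathfrak{H}_n$ with domain $\mathfrak{H}_{n+2}$ it is self-adjoint, is denoted $L_n$ (or just $L$), and $\operatorname{res}L_n=\operatorname{res}L$. $\langle\cdot,\cdot\rangle$ is the duality pairing between $\mathfrak{H}_{-n}$ and $\mathfrak{H}_n$ defined via $\langle\cdot,\cdot\rangle_0$ in the usual way. Fix $m,d\in\mathbb{N}=\{1,2,\dots\}$, an index set $\mathcal{S}$ with $d$ elements, $J:=\{1,\dots,m\}$, and a family of linearly independent functionals $\varphi_\sigma\in\mathfrak{H}_{-m-2}\setminus\mathfrak{H}_{-m-1}$ ($\sigma\in\mathcal{S}$). Put $\langle\varphi,f\rangle:=(\langle\varphi_\sigma,f\rangle)_\sigma\in\mathbb{C}^d$ for $f\in\mathfrak{H}_{m+2}$; $h_{\sigma j}:=b_j(L)^{-1}\varphi_\sigma\in\mathfrak{H}_{-m-2+2j}\setminus\mathfrak{H}_{-m-1+2j}$ for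 $j\in\{1,\dots,m+1\}$; $h_m(c):=\sum_\sigma c_\sigma h_{\sigma m}$, $h_{m+1}(c):=\sum_\sigma c_\sigma h_{\sigma,m+1}$ for $c\in\mathbb{C}^d$. $\mathfrak{K}_A:=\operatorname{span}\{h_{\sigma j}\mid(\sigma,j)\in\mathcal{S}\times J\}$ is an $md$-dimensional space with $\mathfrak{K}_A\cap\mathfrak{H}_{m-1}=\{0\}$; for $k\in\mathfrak{K}_A$, $d(k)=(d_{\sigma j}(k))\in\mathbb{C}^{md}$ is its coordinate vector, $k=\sum d_{\sigma j}(k)h_{\sigma j}$. $\mathfrak{K}^{\min}_A:=\mathfrak{K}_A\cap\mathfrak{H}_{m-2}=h_m(\mathbb{C}^d)$, and $d(h_m(c))=\eta(c):=(\delta_{jm}c_\sigma)_{\sigma j}$. $\mathcal{G}_A=([\mathcal{G}_A]_{\sigma j,\sigma'j'})$ is an invertible Hermitian $md\times md$ matrix (the Gram matrix of the model); $\mathcal{H}_A:=\mathfrak{H}_m\dotplus\mathfrak{K}_A$ (direct sum) has the indefinite inner product $[f+k,f'+k']_A:=\langle f,f'\rangle_m+\langle d(k),\mathcal{G}_Ad(k')\rangle_{\mathbb{C}^{md}}$. Put $[\mathcal{G}^{\min}_A]_{\sigma\sigma'}:=[\mathcal{G}_A]_{\sigma m,\sigma'm}$ (a $d\times d$ matrix). $\mathcal{H}^{\min}_A:=\mathfrak{H}_m\dotplus\mathfrak{K}^{\min}_A\subseteq\mathcal{H}_A$, and $\mathcal{H}^\perp_A$ is the $[\cdot,\cdot]_A$-orthogonal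 complement of $\mathcal{H}^{\min}_A$ in $\mathcal{H}_A$. $\mathfrak{M}$ is the $m\times m$ matrix with $z_1$ on the diagonal, $1$ on the first superdiagonal ($\mathfrak{M}_{j,j+1}=1$) and $0$ elsewhere; $[\mathfrak{M}_d]_{\sigma j,\sigma'j'}:=\delta_{\sigma\sigma'}\mathfrak{M}_{jj'}$. The operator $A_{\max}$ in $\mathcal{H}_A$ (identified with its graph) is $$A_{\max}=\{(f^\#+h_{m+1}(c)+k,\ L_mf^\#+z_1h_{m+1}(c)+\widetilde k)\mid f^\#\in\mathfrak{H}_{m+2},\ c\in\mathbb{C}^d,\ k,\widetilde k\in\mathfrak{K}_A,\ d(\widetilde k)=\mathfrak{M}_dd(k)+\eta(c)\}.$$ The linear relation $B_{\max}$ in $\mathcal{H}_A$ is the componentwise sum $$B_{\max}:=\big(A_{\max}\cap(\mathcal{H}^{\min}_A\times\mathcal{H}_A)\big)\,\widehat{+}\,(\{0\}\times\mathcal{H}^\perp_A).$$ Thus $\widehat f=(f,f')\in B_{\max}$ means $f=f^\#+h_{m+1}(c)+h_m(\chi)$, $f'=L_mf^\#+z_1h_{m+1}(c)+\widetilde k+k_\perp$ with $f^\#\in\mathfrak{H}_{m+2}$, $c,\chi\in\mathbb{C}^d$, $k_\perp\in\mathcal{H}^\perp_A$, $\widetilde k\in\mathfrak{K}_A$, $d(\widetilde k)=\mathfrak{M}_d\eta(\chi)+\eta(c)$; the maps $\Gamma'_0,\Gamma'_1\colon B_{\max}\to\mathbb{C}^d$ are $\Gamma'_0\widehat f:=c$,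 $\Gamma'_1\widehat f:=\langle\varphi,f^\#\rangle-\mathcal{G}^{\min}_A\chi$. The Krein $Q$-function is the $d\times d$ matrix function $[q(z)]_{\sigma\sigma'}:=(z-z_1)\langle\varphi_\sigma,(L-z)^{-1}h_{\sigma',m+1}\rangle$, $z\in\operatorname{res}L$. $\Delta$ is the $d\times d$ matrix $\Delta_{\sigma\sigma'}:=[\mathcal{G}_A\mathfrak{M}_d]_{\sigma m,\sigma'm}$ and $\hat\Delta:=(\mathcal{G}^{\min}_A)^{-1}\Delta$; one has $\operatorname{res}B_0=\operatorname{res}L\cap\operatorname{res}\hat\Delta$. For a relation $T$ in $\mathcal{H}_A$, $(T-z)^{-1}=\{(f'-zf,f)\mid(f,f')\in T\}$, and for a closed relation $T$, $\operatorname{res}T$ is the set of $z\in\mathbb{C}$ for which this is (the graph of) a bounded everywhere defined operator. For a relation $\Theta$ and a matrix $M$ in $\mathbb{C}^d$, $(\Theta-M)^{-1}=\{(c'-Mc,c)\mid(c,c')\in\Theta\}$. *)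

theory Defs
  imports "HOL-Analysis.Analysis"
begin

section \<open>Operators and linear relations in complex Hilbert spaces\<close>

text \<open>
  Hilbert spaces are carriers inside one ambient complex vector space (type \<open>'v\<close>, scalar
  multiplication \<open>sc\<close>), so that a scale of spaces ordered by inclusion can be formed.
  Operators are identified with their graphs.
\<close>

definition ip_norm :: "('v \<Rightarrow> 'v \<Rightarrow> complex) \<Rightarrow> 'v \<Rightarrow> real" where
  "ip_norm ip u = sqrt (Re (ip u u))"

definition complex_hilbert_space ::
  "(complex \<Rightarrow> 'v \<Rightarrow> 'v) \<Rightarrow> 'v::ab_group_add set \<Rightarrow> ('v \<Rightarrow> 'v \<Rightarrow> complex) \<Rightarrow> bool" where
  "complex_hilbert_space sc H ip \<longleftrightarrow>
     module.subspace sc H \<and>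
     (\<forall>u\<in>H. \<forall>v\<in>H. \<forall>w\<in>H. ip u (v + w) = ip u v + ip u w) \<and>
     (\<forall>u\<in>H. \<forall>v\<in>H. \<forall>a. ip u (sc a v) = a * ip u v) \<and>
     (\<forall>u\<in>H. \<forall>v\<in>H. ip v u = cnj (ip u v)) \<and>
     (\<forall>u\<in>H. u \<noteq> 0 \<longrightarrow> 0 < Re (ip u u)) \<and>
     (\<forall>u. (\<forall>k::nat. u k \<in> H) \<and>
          (\<forall>e>0. \<exists>N. \<forall>k\<ge>N. \<forall>l\<ge>N. ip_norm ip (u k - u l) < e) \<longrightarrow>
          (\<exists>v\<in>H. (\<lambda>k. ip_norm ip (u k - v)) \<longlonglongrightarrow> 0))"

definition adjoint_rel :: "'v set \<Rightarrow> ('v \<Rightarrow> 'v \<Rightarrow> complex) \<Rightarrow> 'v rel \<Rightarrow> 'v rel" where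
  "adjoint_rel H ip T = {(g, g'). g \<in> H \<and> g' \<in> H \<and> (\<forall>(f, f')\<in>T. ip g f' = ip g' f)}"

text \<open>A single-valued self-adjoint relation is automatically linear and densely defined.\<close>

definition self_adjoint_op :: "'v set \<Rightarrow> ('v \<Rightarrow> 'v \<Rightarrow> complex) \<Rightarrow> 'v rel \<Rightarrow> bool" where
  "self_adjoint_op H ip T \<longleftrightarrow> single_valued T \<and> adjoint_rel H ip T = T"

definition nonneg_sqrt :: "'v set \<Rightarrow> ('v \<Rightarrow> 'v \<Rightarrow> complex) \<Rightarrow> 'v rel \<Rightarrow> 'v rel \<Rightarrow> bool" where
  "nonneg_sqrt H ip T S \<longleftrightarrow>
     self_adjoint_op H ip S \<and> (\<forall>(f, f')\<in>S. 0 \<le> Re (ip f f')) \<and> S O S = T"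

text \<open>\<open>shifted_inverse M T\<close> is \<open>(T - M)\<inverse>\<close>.\<close>

definition shifted_inverse :: "('b \<Rightarrow> 'b) \<Rightarrow> 'b::ab_group_add rel \<Rightarrow> 'b rel" where
  "shifted_inverse M T = {(f' - M f, f) | f f'. (f, f') \<in> T}"

text \<open>If \<open>T - z\<close> has a bounded everywhere defined inverse, then \<open>T\<close> is automatically closed.\<close>

definition resolvent_set ::
  "(complex \<Rightarrow> 'v \<Rightarrow> 'v) \<Rightarrow> 'v::ab_group_add set \<Rightarrow> ('v \<Rightarrow> real) \<Rightarrow> 'v rel \<Rightarrow> complex set" where
  "resolvent_set sc H N T =
     {z. single_valued (shifted_inverse (sc z) T) \<and>
         Domain (shifted_inverse (sc z) T) = H \<and>
         (\<exists>C. \<forall>(g, u)\<in>shifted_inverse (sc z) T. N u \<le> C * N g)}"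

definition componentwise_sum :: "'b::ab_group_add rel \<Rightarrow> 'b rel \<Rightarrow> 'b rel" where
  "componentwise_sum R T = {(f + g, f' + g') | f f' g g'. (f, f') \<in> R \<and> (g, g') \<in> T}"


section \<open>The scale of Hilbert spaces associated with a self-adjoint operator\<close>

record 'v scale_data =
  scl :: "complex \<Rightarrow> 'v \<Rightarrow> 'v"
  space\<^sub>H :: "int \<Rightarrow> 'v set"
  ip\<^sub>H :: "int \<Rightarrow> 'v \<Rightarrow> 'v \<Rightarrow> complex"
  opL :: "'v \<Rightarrow> 'v"
  zpar :: real

text \<open>Only the values of \<open>opL\<close> on the union of the scale are used; it is a linear map of the whole
  ambient space for convenience (every linear map on a subspace extends).\<close>

definition norm\<^sub>H :: "('v, 'x) scale_data_scheme \<Rightarrow> int \<Rightarrow> 'v \<Rightarrow> real" where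
  "norm\<^sub>H X n = ip_norm (ip\<^sub>H X n)"

definition graphL :: "('v, 'x) scale_data_scheme \<Rightarrow> int \<Rightarrow> 'v rel" where
  "graphL X n = {(u, opL X u) | u. u \<in> space\<^sub>H X (n + 2)}"

definition resL :: "('v::ab_group_add, 'x) scale_data_scheme \<Rightarrow> complex set" where
  "resL X = resolvent_set (scl X) (space\<^sub>H X 0) (norm\<^sub>H X 0) (graphL X 0)"

text \<open>
  The scalar product of order \<open>n\<close> is that of the images under \<open>b\<^sub>n(L)\<close> to the power one half,
  where \<open>b\<^sub>n(L) = (L - z\<^sub>1)\<close> to the power \<open>n\<close>. As \<open>z\<^sub>1\<close> is only required to be a real
  point of the resolvent set, \<open>L - z\<^sub>1\<close> need not be nonnegative; but whichever square root is
  used, the scalar product equals the one obtained from the \<open>n\<close>-th power of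
  \<open>S = \<bar>L - z\<^sub>1\<bar>\<close> to the power one half. Here \<open>S\<close> is the nonnegative square root of \<open>A\<close>, and
  \<open>A = \<bar>L - z\<^sub>1\<bar>\<close> is the nonnegative square root of the square of \<open>L - z\<^sub>1\<close>
  (and \<open>A = L - z\<^sub>1\<close> if \<open>z\<^sub>1\<close> lies below the spectrum).
\<close>

definition is_sqrt_abs_shift :: "('v::ab_group_add, 'x) scale_data_scheme \<Rightarrow> 'v rel \<Rightarrow> bool" where
  "is_sqrt_abs_shift X S \<longleftrightarrow>
     (let T = {(u, opL X u - scl X (of_real (zpar X)) u) | u. u \<in> space\<^sub>H X 2}
      in \<exists>A. nonneg_sqrt (space\<^sub>H X 0) (ip\<^sub>H X 0) (T O T) A \<and>
             nonneg_sqrt (space\<^sub>H X 0) (ip\<^sub>H X 0) A S)"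

text \<open>
  For \<open>n > 0\<close> the space of order \<open>n\<close> is the domain of the \<open>n\<close>-th power of \<open>S\<close>, and the space of
  order \<open>-n\<close> is a completion of the space of order \<open>0\<close> in the norm given by the \<open>n\<close>-th power
  of the inverse of \<open>S\<close>. The completions of different orders are compatible with each other
  (continuous inclusions), and \<open>L\<close> acts by continuity.
\<close>

definition hilbert_scale :: "('v::ab_group_add, 'x) scale_data_scheme \<Rightarrow> bool" where
  "hilbert_scale X \<longleftrightarrow>
     vector_space (scl X) \<and>
     Vector_Spaces.linear (scl X) (scl X) (opL X) \<and>
     (\<forall>n. complex_hilbert_space (scl X) (space\<^sub>H X n) (ip\<^sub>H X n)) \<and>
     self_adjoint_op (space\<^sub>H X 0) (ip\<^sub>H X 0) (graphL X 0) \<and>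
     (\<exists>\<gamma>::real. \<forall>u\<in>space\<^sub>H X 2. \<gamma> * Re (ip\<^sub>H X 0 u u) \<le> Re (ip\<^sub>H X 0 u (opL X u))) \<and>
     of_real (zpar X) \<in> resL X \<and>
     (\<exists>S. is_sqrt_abs_shift X S \<and>
       (\<forall>n>0.
          space\<^sub>H X (int n) = Domain (S ^^ n) \<and>
          (\<forall>(u, u')\<in>S ^^ n. \<forall>(v, v')\<in>S ^^ n. ip\<^sub>H X (int n) u v = ip\<^sub>H X 0 u' v') \<and>
          (\<forall>(u', u)\<in>S ^^ n. \<forall>(v', v)\<in>S ^^ n. ip\<^sub>H X (- int n) u v = ip\<^sub>H X 0 u' v'))) \<and>
     (\<forall>n<0. \<forall>u\<in>space\<^sub>H X n. \<forall>e>0. \<exists>v\<in>space\<^sub>H X 0. norm\<^sub>H X n (u - v) < e) \<and>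
     (\<forall>n. space\<^sub>H X (n + 1) \<subseteq> space\<^sub>H X n \<and>
          (\<exists>C. \<forall>u\<in>space\<^sub>H X (n + 1). norm\<^sub>H X n u \<le> C * norm\<^sub>H X (n + 1) u)) \<and>
     (\<forall>n. opL X ` space\<^sub>H X (n + 2) \<subseteq> space\<^sub>H X n \<and>
          (\<exists>C. \<forall>u\<in>space\<^sub>H X (n + 2). norm\<^sub>H X n (opL X u) \<le> C * norm\<^sub>H X (n + 2) u))"

text \<open>
  \<open>(L - z)\<inverse>\<close> and \<open>b\<^sub>j(L)\<inverse>\<close> act on all spaces of the scale, consistently with the inclusions;
  hence no index for the space is needed.
\<close>

definition Lres :: "('v::ab_group_add, 'x) scale_data_scheme \<Rightarrow> complex \<Rightarrow> 'v \<Rightarrow> 'v" where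
  "Lres X z g = (THE u. u \<in> (\<Union>n. space\<^sub>H X n) \<and> opL X u - scl X z u = g)"

definition bL :: "('v::ab_group_add, 'x) scale_data_scheme \<Rightarrow> nat \<Rightarrow> 'v \<Rightarrow> 'v" where
  "bL X j = (\<lambda>u. opL X u - scl X (of_real (zpar X)) u) ^^ j"

definition bL_inv :: "('v::ab_group_add, 'x) scale_data_scheme \<Rightarrow> nat \<Rightarrow> 'v \<Rightarrow> 'v" where
  "bL_inv X j g = (THE u. u \<in> (\<Union>n. space\<^sub>H X n) \<and> bL X j u = g)"

text \<open>The duality pairing between the spaces of order \<open>-n\<close> and \<open>n\<close> (\<open>n \<ge> 0\<close>): the continuous
  extension of the scalar product of order \<open>0\<close> in its first argument.\<close>

definition pairing :: "('v::ab_group_add, 'x) scale_data_scheme \<Rightarrow> int \<Rightarrow> 'v \<Rightarrow> 'v \<Rightarrow> complex" where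
  "pairing X n \<psi> f =
     (THE c. \<forall>u. (\<forall>k::nat. u k \<in> space\<^sub>H X 0) \<and> (\<lambda>k. norm\<^sub>H X (- n) (u k - \<psi>)) \<longlonglongrightarrow> 0 \<longrightarrow>
                 (\<lambda>k. ip\<^sub>H X 0 (u k) f) \<longlonglongrightarrow> c)"


section \<open>The peak model\<close>

text \<open>The index set of the functionals is the finite type \<open>'i\<close>, so \<open>d = CARD('i)\<close>; \<open>ord\<^sub>m\<close> is \<open>m\<close>.
  Vectors and matrices of size \<open>m d\<close> are functions on \<open>'i \<times> nat\<close>, of which only the values on
  \<open>UNIV \<times> {1..m}\<close> matter.\<close>

record ('v, 'i) peak_data = "'v scale_data" +
  ord\<^sub>m :: nat
  func :: "'i \<Rightarrow> 'v"
  gram :: "'i \<times> nat \<Rightarrow> 'i \<times> nat \<Rightarrow> complex"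

type_synonym 'i cvec = "complex ^ 'i"
type_synonym 'i cmat = "complex ^ 'i ^ 'i"

definition idx :: "('v, 'i) peak_data \<Rightarrow> ('i \<times> nat) set" where
  "idx X = UNIV \<times> {1..ord\<^sub>m X}"

definition hvec :: "('v::ab_group_add, 'i) peak_data \<Rightarrow> 'i \<Rightarrow> nat \<Rightarrow> 'v" where
  "hvec X \<sigma> j = bL_inv X j (func X \<sigma>)"

definition hcomb :: "('v::ab_group_add, 'i::finite) peak_data \<Rightarrow> nat \<Rightarrow> 'i cvec \<Rightarrow> 'v" where
  "hcomb X j c = (\<Sum>\<sigma>\<in>UNIV. scl X (c $ \<sigma>) (hvec X \<sigma> j))"

definition K\<^sub>A :: "('v::ab_group_add, 'i) peak_data \<Rightarrow> 'v set" where
  "K\<^sub>A X = module.span (scl X) {hvec X \<sigma> j | \<sigma> j. (\<sigma>, j) \<in> idx X}"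

definition K\<^sub>A_min :: "('v::ab_group_add, 'i) peak_data \<Rightarrow> 'v set" where
  "K\<^sub>A_min X = K\<^sub>A X \<inter> space\<^sub>H X (int (ord\<^sub>m X) - 2)"

definition coord :: "('v::ab_group_add, 'i::finite) peak_data \<Rightarrow> 'v \<Rightarrow> 'i \<times> nat \<Rightarrow> complex" where
  "coord X k = (THE a. (\<forall>p. p \<notin> idx X \<longrightarrow> a p = 0) \<and>
                       k = (\<Sum>p\<in>idx X. scl X (a p) (hvec X (fst p) (snd p))))"

definition eta :: "('v, 'i::finite) peak_data \<Rightarrow> 'i cvec \<Rightarrow> 'i \<times> nat \<Rightarrow> complex" where
  "eta X c p = (if snd p = ord\<^sub>m X then c $ fst p else 0)"

definition gram_hermitian :: "('v, 'i) peak_data \<Rightarrow> bool" where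
  "gram_hermitian X \<longleftrightarrow> (\<forall>p\<in>idx X. \<forall>q\<in>idx X. gram X p q = cnj (gram X q p))"

definition gram_invertible :: "('v, 'i::finite) peak_data \<Rightarrow> bool" where
  "gram_invertible X \<longleftrightarrow>
     (\<exists>B. \<forall>p\<in>idx X. \<forall>q\<in>idx X.
        (\<Sum>r\<in>idx X. gram X p r * B r q) = (if p = q then 1 else 0) \<and>
        (\<Sum>r\<in>idx X. B p r * gram X r q) = (if p = q then 1 else 0))"

definition gram_min :: "('v, 'i::finite) peak_data \<Rightarrow> 'i cmat" where
  "gram_min X = (\<chi> \<sigma> \<sigma>'. gram X (\<sigma>, ord\<^sub>m X) (\<sigma>', ord\<^sub>m X))"

definition positive_definite :: "'i::finite cmat \<Rightarrow> bool" where
  "positive_definite A \<longleftrightarrow>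
     (\<forall>i j. A $ i $ j = cnj (A $ j $ i)) \<and>
     (\<forall>c. c \<noteq> 0 \<longrightarrow> 0 < Re (\<Sum>i\<in>UNIV. cnj (c $ i) * (A *v c) $ i))"

text \<open>The space \<open>\<H>\<^sub>A\<close>, an internal direct sum, with its projection onto the first summand along
  \<open>K\<^sub>A\<close>, its indefinite inner product and its (Hilbert space) norm.\<close>

definition H\<^sub>A :: "('v::ab_group_add, 'i) peak_data \<Rightarrow> 'v set" where
  "H\<^sub>A X = {f + k | f k. f \<in> space\<^sub>H X (int (ord\<^sub>m X)) \<and> k \<in> K\<^sub>A X}"

definition projH :: "('v::ab_group_add, 'i) peak_data \<Rightarrow> 'v \<Rightarrow> 'v" where
  "projH X x = (THE f. f \<in> space\<^sub>H X (int (ord\<^sub>m X)) \<and> x - f \<in> K\<^sub>A X)"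

definition ip\<^sub>A :: "('v::ab_group_add, 'i::finite) peak_data \<Rightarrow> 'v \<Rightarrow> 'v \<Rightarrow> complex" where
  "ip\<^sub>A X x y =
     ip\<^sub>H X (int (ord\<^sub>m X)) (projH X x) (projH X y) +
     (\<Sum>p\<in>idx X. cnj (coord X (x - projH X x) p) *
                 (\<Sum>q\<in>idx X. gram X p q * coord X (y - projH X y) q))"

definition norm\<^sub>A :: "('v::ab_group_add, 'i::finite) peak_data \<Rightarrow> 'v \<Rightarrow> real" where
  "norm\<^sub>A X x = sqrt ((norm\<^sub>H X (int (ord\<^sub>m X)) (projH X x))\<^sup>2 +
                    (\<Sum>p\<in>idx X. (cmod (coord X (x - projH X x) p))\<^sup>2))"

definition H\<^sub>A_min :: "('v::ab_group_add, 'i) peak_data \<Rightarrow> 'v set" where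
  "H\<^sub>A_min X = {f + k | f k. f \<in> space\<^sub>H X (int (ord\<^sub>m X)) \<and> k \<in> K\<^sub>A_min X}"

definition H\<^sub>A_perp :: "('v::ab_group_add, 'i::finite) peak_data \<Rightarrow> 'v set" where
  "H\<^sub>A_perp X = {x \<in> H\<^sub>A X. \<forall>y\<in>H\<^sub>A_min X. ip\<^sub>A X y x = 0}"

text \<open>
  The standing assumptions. For \<open>d \<ge> 2\<close>, linear independence of the functionals alone does not
  give \<open>K\<^sub>A \<inter> H\<^sub>m\<^sub>-\<^sub>1 = {0}\<close> (a nontrivial linear combination could be less singular), so this
  condition is listed; together with the rest it implies that \<open>dim K\<^sub>A = m d\<close> and that the sum
  defining \<open>\<H>\<^sub>A\<close> is direct.
\<close>

definition peak_model :: "('v::ab_group_add, 'i::finite) peak_data \<Rightarrow> bool" where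
  "peak_model X \<longleftrightarrow>
     hilbert_scale X \<and>
     1 \<le> ord\<^sub>m X \<and>
     (\<forall>\<sigma>. func X \<sigma> \<in> space\<^sub>H X (- int (ord\<^sub>m X) - 2) - space\<^sub>H X (- int (ord\<^sub>m X) - 1)) \<and>
     inj (func X) \<and> \<not> module.dependent (scl X) (range (func X)) \<and>
     K\<^sub>A X \<inter> space\<^sub>H X (int (ord\<^sub>m X) - 1) = {0}"


section \<open>The relations \<open>A\<^sub>m\<^sub>a\<^sub>x\<close> and \<open>B\<^sub>m\<^sub>a\<^sub>x\<close>, boundary maps and the Weyl function\<close>

definition Mmat :: "('v, 'i) peak_data \<Rightarrow> nat \<Rightarrow> nat \<Rightarrow> complex" where
  "Mmat X j j' = (if j = j' then of_real (zpar X) else if j' = j + 1 then 1 else 0)"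

definition Mdmat :: "('v, 'i) peak_data \<Rightarrow> 'i \<times> nat \<Rightarrow> 'i \<times> nat \<Rightarrow> complex" where
  "Mdmat X p q = (if fst p = fst q then Mmat X (snd p) (snd q) else 0)"

definition Md_apply ::
  "('v, 'i::finite) peak_data \<Rightarrow> ('i \<times> nat \<Rightarrow> complex) \<Rightarrow> 'i \<times> nat \<Rightarrow> complex" where
  "Md_apply X a p = (\<Sum>q\<in>idx X. Mdmat X p q * a q)"

definition A_max :: "('v::ab_group_add, 'i::finite) peak_data \<Rightarrow> 'v rel" where
  "A_max X =
     {(f + hcomb X (ord\<^sub>m X + 1) c + k,
       opL X f + scl X (of_real (zpar X)) (hcomb X (ord\<^sub>m X + 1) c) + k') | f c k k'.
      f \<in> space\<^sub>H X (int (ord\<^sub>m X) + 2) \<and> k \<in> K\<^sub>A X \<and> k' \<in> K\<^sub>A X \<and>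
      (\<forall>p\<in>idx X. coord X k' p = Md_apply X (coord X k) p + eta X c p)}"

definition B_max :: "('v::ab_group_add, 'i::finite) peak_data \<Rightarrow> 'v rel" where
  "B_max X = componentwise_sum (A_max X \<inter> (H\<^sub>A_min X \<times> H\<^sub>A X)) ({0} \<times> H\<^sub>A_perp X)"

text \<open>\<open>B_decomp X x f c a\<close>: the element \<open>x\<close> of \<open>B_max\<close> is represented by the regular part \<open>f\<close> and
  the vectors \<open>c\<close> and \<open>a\<close> (the latter written \<open>\<chi>\<close> on paper). The representation is unique.\<close>

definition B_decomp ::
  "('v::ab_group_add, 'i::finite) peak_data \<Rightarrow> 'v \<times> 'v \<Rightarrow> 'v \<Rightarrow> 'i cvec \<Rightarrow> 'i cvec \<Rightarrow> bool" where
  "B_decomp X x f c a \<longleftrightarrow>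
     f \<in> space\<^sub>H X (int (ord\<^sub>m X) + 2) \<and>
     fst x = f + hcomb X (ord\<^sub>m X + 1) c + hcomb X (ord\<^sub>m X) a \<and>
     (\<exists>k'\<in>K\<^sub>A X. \<exists>k\<in>H\<^sub>A_perp X.
        (\<forall>p\<in>idx X. coord X k' p = Md_apply X (eta X a) p + eta X c p) \<and>
        snd x = opL X f + scl X (of_real (zpar X)) (hcomb X (ord\<^sub>m X + 1) c) + k' + k)"

definition phi_vec :: "('v::ab_group_add, 'i::finite) peak_data \<Rightarrow> 'v \<Rightarrow> 'i cvec" where
  "phi_vec X f = (\<chi> \<sigma>. pairing X (int (ord\<^sub>m X) + 2) (func X \<sigma>) f)"

definition Gamma0 :: "('v::ab_group_add, 'i::finite) peak_data \<Rightarrow> 'v \<times> 'v \<Rightarrow> 'i cvec" where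
  "Gamma0 X x = (THE c. \<exists>f a. B_decomp X x f c a)"

definition Gamma1 :: "('v::ab_group_add, 'i::finite) peak_data \<Rightarrow> 'v \<times> 'v \<Rightarrow> 'i cvec" where
  "Gamma1 X x = (THE w. \<exists>f c a. B_decomp X x f c a \<and> w = phi_vec X f - gram_min X *v a)"

definition linear_relation :: "'i::finite cvec rel \<Rightarrow> bool" where
  "linear_relation \<Theta> \<longleftrightarrow>
     (0, 0) \<in> \<Theta> \<and>
     (\<forall>(c, c')\<in>\<Theta>. \<forall>(e, e')\<in>\<Theta>. (c + e, c' + e') \<in> \<Theta>) \<and>
     (\<forall>a. \<forall>(c, c')\<in>\<Theta>. (a *s c, a *s c') \<in> \<Theta>)"

definition B_Theta :: "('v::ab_group_add, 'i::finite) peak_data \<Rightarrow> 'i cvec rel \<Rightarrow> 'v rel" where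
  "B_Theta X \<Theta> = {x \<in> B_max X. (Gamma0 X x, Gamma1 X x) \<in> \<Theta>}"

definition B_zero :: "('v::ab_group_add, 'i::finite) peak_data \<Rightarrow> 'v rel" where
  "B_zero X = {x \<in> B_max X. Gamma0 X x = 0}"

definition res\<^sub>A :: "('v::ab_group_add, 'i::finite) peak_data \<Rightarrow> 'v rel \<Rightarrow> complex set" where
  "res\<^sub>A X T = resolvent_set (scl X) (H\<^sub>A X) (norm\<^sub>A X) T"

definition Krein_Q :: "('v::ab_group_add, 'i::finite) peak_data \<Rightarrow> complex \<Rightarrow> 'i cmat" where
  "Krein_Q X z = (\<chi> \<sigma> \<sigma>'. (z - of_real (zpar X)) *
     pairing X (int (ord\<^sub>m X) + 2) (func X \<sigma>) (Lres X z (hvec X \<sigma>' (ord\<^sub>m X + 1))))"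

definition Delta :: "('v, 'i::finite) peak_data \<Rightarrow> 'i cmat" where
  "Delta X = (\<chi> \<sigma> \<sigma>'. \<Sum>r\<in>idx X. gram X (\<sigma>, ord\<^sub>m X) r * Mdmat X r (\<sigma>', ord\<^sub>m X))"

definition Delta_hat :: "('v, 'i::finite) peak_data \<Rightarrow> 'i cmat" where
  "Delta_hat X = matrix_inv (gram_min X) ** Delta X"

definition Weyl_M :: "('v::ab_group_add, 'i::finite) peak_data \<Rightarrow> complex \<Rightarrow> 'i cmat" where
  "Weyl_M X z = Krein_Q X z + gram_min X ** matrix_inv (Delta_hat X - mat z)"

end

(* The proof solves u' - z u = f for (u, u') in B_max, with f in H_m, componentwise. Writing
   u = f# + h_(m+1)(c) + h_m(a), the H_m component gives f# in terms of f and c, and orthogonality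
   of the remaining K_A component to H_A_min gives a = - (hat Delta - z)^(-1) c. Then
   Gamma_1 = <phi, (L - z)^(-1) f> + M(z) c, so that the condition defining B_Theta is the one
   defining (Theta - M(z))^(-1). The case c = 0 shows that z in res B_0 makes L - z bijective from
   H_(m+2) to H_m and hat Delta - z invertible.

   L - z_1 is bijective between all spaces H_(n+2) and H_n because the square root of |L - z_1|
   commutes with (L - z_1)^(-1); for L - z, bijectivity then propagates from n = m to all n. *)

theory Submission
  imports Defs
begin

section \<open>Bounded symmetric maps on a Hilbert space\<close>

text \<open>Since \<open>z1\<close> is only a real point of the resolvent set, L - z_1 may be
  indefinite, and the scale is given by two nested nonnegative square roots, of (L - z_1)^2 and of
  |L - z_1|. Let t, a, s be the inverses of L - z_1, |L - z_1| and the root of the latter. Then a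
  need not equal t; only a^2 = t^2 is available. A nonnegative injective map commutes with t as soon
  as its square does: this applies to a, whose square is t^2, and thereby to s, whose square is a.
  From s^4 = t^2 it follows that t v and s^2 v have equal norms, so L - z_1 preserves norms across
  two orders. Spaces of negative order are known only as completions, so this isometry is extended
  by density.

  Orders below m cannot be avoided: the vectors h are built from functionals of order -m-2, and the
  final formula applies (L - z)^(-1) to h_(sigma m), which is only of order m-2.

  Uniqueness of coordinates rests on the independence of the functionals and on K_A meeting H_(m-1)
  only in 0; powers of L - z_1 connect each layer of h's with these two facts.\<close>

locale hilbert_carrier = vector_space sc
  for sc :: "complex \<Rightarrow> 'v::ab_group_add \<Rightarrow> 'v" +
  fixes H :: "'v set" and ip :: "'v \<Rightarrow> 'v \<Rightarrow> complex"
  assumes hilbert: "complex_hilbert_space sc H ip"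
begin

section \<open>Scalar product, norm and convergence on the carrier\<close>

abbreviation nrm :: "'v \<Rightarrow> real" where "nrm \<equiv> ip_norm ip"

lemma subspace_H: "subspace H"
  using hilbert by (simp add: complex_hilbert_space_def)

lemma mem_0 [simp]: "0 \<in> H"
  and mem_add [simp]: "u \<in> H \<Longrightarrow> v \<in> H \<Longrightarrow> u + v \<in> H"
  and mem_diff [simp]: "u \<in> H \<Longrightarrow> v \<in> H \<Longrightarrow> u - v \<in> H"
  and mem_neg [simp]: "u \<in> H \<Longrightarrow> - u \<in> H"
  and mem_sc [simp]: "u \<in> H \<Longrightarrow> sc a u \<in> H"
  using subspace_H by (auto intro: subspace_0 subspace_add subspace_diff subspace_neg subspace_scale)

lemma ip_add_right: "u \<in> H \<Longrightarrow> v \<in> H \<Longrightarrow> w \<in> H \<Longrightarrow> ip u (v + w) = ip u v + ip u w"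
  and ip_sc_right: "u \<in> H \<Longrightarrow> v \<in> H \<Longrightarrow> ip u (sc a v) = a * ip u v"
  and ip_commute: "u \<in> H \<Longrightarrow> v \<in> H \<Longrightarrow> ip v u = cnj (ip u v)"
  and ip_pos: "u \<in> H \<Longrightarrow> u \<noteq> 0 \<Longrightarrow> 0 < Re (ip u u)"
  using hilbert unfolding complex_hilbert_space_def by blast+

lemma complete:
  assumes "\<And>k::nat. u k \<in> H" "\<And>e. e > 0 \<Longrightarrow> \<exists>N. \<forall>k\<ge>N. \<forall>l\<ge>N. nrm (u k - u l) < e"
  shows "\<exists>v\<in>H. (\<lambda>k. nrm (u k - v)) \<longlonglongrightarrow> 0"
  using hilbert assms unfolding complex_hilbert_space_def by blast

lemma ip_add_left: "u \<in> H \<Longrightarrow> v \<in> H \<Longrightarrow> w \<in> H \<Longrightarrow> ip (v + w) u = ip v u + ip w u"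
  using ip_commute[of u] ip_add_right[of u v w] by simp

lemma ip_sc_left: "u \<in> H \<Longrightarrow> v \<in> H \<Longrightarrow> ip (sc a v) u = cnj a * ip v u"
  using ip_commute[of u] ip_sc_right[of u v a] by simp

lemma ip_neg_right: "u \<in> H \<Longrightarrow> v \<in> H \<Longrightarrow> ip u (- v) = - ip u v"
  using ip_sc_right[of u v "-1"] by simp

lemma ip_neg_left: "u \<in> H \<Longrightarrow> v \<in> H \<Longrightarrow> ip (- v) u = - ip v u"
  using ip_sc_left[of u v "-1"] by simp

lemma ip_diff_right: "u \<in> H \<Longrightarrow> v \<in> H \<Longrightarrow> w \<in> H \<Longrightarrow> ip u (v - w) = ip u v - ip u w"
  using ip_add_right[of u v "-w"] ip_neg_right[of u w] by simp

lemma ip_diff_left: "u \<in> H \<Longrightarrow> v \<in> H \<Longrightarrow> w \<in> H \<Longrightarrow> ip (v - w) u = ip v u - ip w u"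
  using ip_add_left[of u v "-w"] ip_neg_left[of u w] by simp

lemmas ip_simps = ip_add_right ip_add_left ip_diff_right ip_diff_left ip_sc_right ip_sc_left

lemma ip_0_right [simp]: "u \<in> H \<Longrightarrow> ip u 0 = 0"
  using ip_diff_right[of u u u] by simp

lemma ip_0_left [simp]: "u \<in> H \<Longrightarrow> ip 0 u = 0"
  using ip_diff_left[of u u u] by simp

lemma Re_ip_nonneg: "u \<in> H \<Longrightarrow> 0 \<le> Re (ip u u)"
  by (cases "u = 0") (use ip_pos[of u] in auto)

lemma nrm_nonneg: "u \<in> H \<Longrightarrow> 0 \<le> nrm u"
  by (simp add: ip_norm_def Re_ip_nonneg)

lemma nrm_sq: "u \<in> H \<Longrightarrow> (nrm u)\<^sup>2 = Re (ip u u)"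
  by (simp add: ip_norm_def Re_ip_nonneg)

lemma ip_self: "u \<in> H \<Longrightarrow> ip u u = of_real ((nrm u)\<^sup>2)"
  using ip_commute[of u u] by (auto simp: nrm_sq complex_eq_iff)

lemma nrm_0 [simp]: "nrm 0 = 0"
  by (simp add: ip_norm_def)

lemma nrm_eq_0: "u \<in> H \<Longrightarrow> nrm u = 0 \<Longrightarrow> u = 0"
  using ip_pos[of u] nrm_sq[of u] by fastforce

lemma eq_if_ip_eq:
  assumes "u \<in> H" "v \<in> H" "\<And>w. w \<in> H \<Longrightarrow> ip u w = ip v w" shows "u = v"
proof -
  have "ip (u - v) (u - v) = 0" using assms by (simp add: ip_diff_left)
  then show ?thesis using ip_pos[of "u - v"] assms by fastforce
qed

lemma Re_ip_commute: "u \<in> H \<Longrightarrow> v \<in> H \<Longrightarrow> Re (ip v u) = Re (ip u v)"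
  using ip_commute[of u v] by simp

lemma nrm_add_sq:
  "u \<in> H \<Longrightarrow> v \<in> H \<Longrightarrow> (nrm (u + v))\<^sup>2 = (nrm u)\<^sup>2 + 2 * Re (ip u v) + (nrm v)\<^sup>2"
  using Re_ip_commute[of u v] by (simp add: nrm_sq ip_simps)

lemma nrm_diff_sq:
  "u \<in> H \<Longrightarrow> v \<in> H \<Longrightarrow> (nrm (u - v))\<^sup>2 = (nrm u)\<^sup>2 - 2 * Re (ip u v) + (nrm v)\<^sup>2"
  using Re_ip_commute[of u v] by (simp add: nrm_sq ip_simps)

lemma nrm_sc: "u \<in> H \<Longrightarrow> nrm (sc a u) = cmod a * nrm u"
proof -
  assume u: "u \<in> H"
  have "(nrm (sc a u))\<^sup>2 = Re (a * cnj a * ip u u)"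
    using u by (simp add: nrm_sq ip_simps mult.assoc mult.commute mult.left_commute)
  also have "\<dots> = (cmod a * nrm u)\<^sup>2"
    unfolding ip_self[OF u] complex_norm_square[symmetric] by (simp add: power_mult_distrib)
  finally show ?thesis
    using u by (simp add: power2_eq_iff_nonneg nrm_nonneg)
qed

lemma cauchy_schwarz:
  assumes u: "u \<in> H" and v: "v \<in> H" shows "cmod (ip u v) \<le> nrm u * nrm v"
proof (cases "v = 0")
  case False
  define n where "n = (nrm v)\<^sup>2"
  have n: "n > 0" using False v ip_pos by (simp add: n_def nrm_sq)
  \<comment> \<open>The coefficient of the orthogonal projection of \<open>u\<close> onto
    \<open>v\<close>; expanding the squared norm of the residual yields the inequality.\<close>
  define a where "a = ip v u / of_real n"
  have ipvu: "ip v u = cnj (ip u v)" using u v ip_commute by blast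
  have "0 \<le> (nrm (u - sc a v))\<^sup>2" by simp
  also have "\<dots> = (nrm u)\<^sup>2 - 2 * Re (a * ip u v) + (cmod a)\<^sup>2 * n"
    using u v by (simp add: nrm_diff_sq ip_sc_right nrm_sc n_def power_mult_distrib)
  also have "a * ip u v = of_real ((cmod (ip u v))\<^sup>2 / n)"
    unfolding a_def ipvu using complex_norm_square[of "ip u v"] by (simp add: mult.commute)
  also have "(cmod a)\<^sup>2 * n = (cmod (ip u v))\<^sup>2 / n"
    unfolding a_def ipvu using n by (simp add: norm_divide power_divide power2_eq_square)
  finally have "(cmod (ip u v))\<^sup>2 / n \<le> (nrm u)\<^sup>2" by simp
  then have "(cmod (ip u v))\<^sup>2 \<le> (nrm u * nrm v)\<^sup>2"
    using n by (simp add: field_simps power_mult_distrib n_def)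
  then show ?thesis
    using u v by (auto intro!: power2_le_imp_le simp: nrm_nonneg)
qed (use u in auto)

lemma nrm_add: "u \<in> H \<Longrightarrow> v \<in> H \<Longrightarrow> nrm (u + v) \<le> nrm u + nrm v"
proof -
  assume uv: "u \<in> H" "v \<in> H"
  have "(nrm (u + v))\<^sup>2 \<le> (nrm u + nrm v)\<^sup>2"
    unfolding nrm_add_sq[OF uv]
    using cauchy_schwarz[OF uv] complex_Re_le_cmod[of "ip u v"] by (simp add: power2_sum)
  then show ?thesis using uv by (auto intro!: power2_le_imp_le simp: nrm_nonneg)
qed

lemma nrm_neg: "u \<in> H \<Longrightarrow> nrm (- u) = nrm u"
  using nrm_sc[of u "-1"] by simp

lemma nrm_minus_commute: "u \<in> H \<Longrightarrow> v \<in> H \<Longrightarrow> nrm (u - v) = nrm (v - u)"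
  using nrm_neg[of "u - v"] by simp

lemma nrm_triangle: "u \<in> H \<Longrightarrow> v \<in> H \<Longrightarrow> w \<in> H \<Longrightarrow> nrm (u - w) \<le> nrm (u - v) + nrm (v - w)"
  using nrm_add[of "u - v" "v - w"] by simp

lemma limit_unique:
  assumes "\<And>k::nat. u k \<in> H" "v \<in> H" "w \<in> H"
    and "(\<lambda>k. nrm (u k - v)) \<longlonglongrightarrow> 0" "(\<lambda>k. nrm (u k - w)) \<longlonglongrightarrow> 0"
  shows "v = w"
proof -
  have "(\<lambda>k. nrm (u k - v) + nrm (u k - w)) \<longlonglongrightarrow> 0"
    using tendsto_add[OF assms(4,5)] by simp
  moreover have "nrm (v - w) \<le> nrm (u k - v) + nrm (u k - w)" for k
    using nrm_triangle[of v "u k" w] nrm_minus_commute[of v "u k"] assms by simp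
  ultimately have "nrm (v - w) \<le> 0"
    by (meson LIMSEQ_le_const)
  then show ?thesis
    using nrm_eq_0[of "v - w"] nrm_nonneg[of "v - w"] assms by simp
qed

lemma convergent_imp_cauchy:
  assumes "\<And>k::nat. u k \<in> H" "v \<in> H" "(\<lambda>k. nrm (u k - v)) \<longlonglongrightarrow> 0" "e > 0"
  shows "\<exists>N. \<forall>k\<ge>N. \<forall>l\<ge>N. nrm (u k - u l) < e"
proof -
  obtain N where N: "\<And>k. k \<ge> N \<Longrightarrow> nrm (u k - v) < e / 2"
    using order_tendstoD(2)[OF assms(3), of "e / 2"] assms(4)
    by (auto simp: eventually_sequentially)
  have "nrm (u k - u l) < e" if "k \<ge> N" "l \<ge> N" for k l
    using nrm_triangle[of "u k" v "u l"] nrm_minus_commute[of v "u l"] assms N[OF that(1)] N[OF that(2)]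
    by simp
  then show ?thesis by blast
qed

text \<open>Linearity is left out because symmetry on all of \<open>H\<close> implies it: test
  against an arbitrary vector and move the map across. Only values on the carrier are
  constrained.\<close>

definition bsym :: "('v \<Rightarrow> 'v) \<Rightarrow> bool" where
  "bsym a \<longleftrightarrow> (\<forall>x\<in>H. a x \<in> H) \<and> (\<forall>x\<in>H. \<forall>y\<in>H. ip (a x) y = ip x (a y)) \<and>
     (\<exists>C. \<forall>x\<in>H. nrm (a x) \<le> C * nrm x)"

lemma bsym_mem: "bsym a \<Longrightarrow> x \<in> H \<Longrightarrow> a x \<in> H"
  and bsym_sym: "bsym a \<Longrightarrow> x \<in> H \<Longrightarrow> y \<in> H \<Longrightarrow> ip (a x) y = ip x (a y)"
  by (auto simp: bsym_def)

lemma bsym_bound: 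
  assumes "bsym a" obtains C where "C > 0" "\<And>x. x \<in> H \<Longrightarrow> nrm (a x) \<le> C * nrm x"
proof -
  obtain C where C: "\<And>x. x \<in> H \<Longrightarrow> nrm (a x) \<le> C * nrm x" using assms unfolding bsym_def by blast
  have "nrm (a x) \<le> max 1 C * nrm x" if "x \<in> H" for x
    using C[OF that] mult_right_mono[of C "max 1 C" "nrm x"] nrm_nonneg[OF that] by linarith
  then show ?thesis using that[of "max 1 C"] by simp
qed

lemma bsym_add: "bsym a \<Longrightarrow> x \<in> H \<Longrightarrow> y \<in> H \<Longrightarrow> a (x + y) = a x + a y"
  by (rule eq_if_ip_eq) (simp_all add: bsym_mem bsym_sym ip_simps)

lemma bsym_sc: "bsym a \<Longrightarrow> x \<in> H \<Longrightarrow> a (sc c x) = sc c (a x)"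
  by (rule eq_if_ip_eq) (simp_all add: bsym_mem bsym_sym ip_simps)

lemma bsym_diff: "bsym a \<Longrightarrow> x \<in> H \<Longrightarrow> y \<in> H \<Longrightarrow> a (x - y) = a x - a y"
  by (rule eq_if_ip_eq) (simp_all add: bsym_mem bsym_sym ip_simps)

lemma bsym_0: "bsym a \<Longrightarrow> a 0 = 0"
  using bsym_diff[of a 0 0] by simp

lemma bsym_funpow: "bsym a \<Longrightarrow> bsym (a ^^ n)"
proof (induction n)
  case 0
  then show ?case by (auto simp: bsym_def intro: exI[of _ 1])
next
  case (Suc n)
  note a = \<open>bsym a\<close>
  have an: "bsym (a ^^ n)" using Suc by simp
  obtain C where C: "C > 0" "\<And>x. x \<in> H \<Longrightarrow> nrm (a x) \<le> C * nrm x" using bsym_bound[OF a] by blast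
  obtain D where D: "D > 0" "\<And>x. x \<in> H \<Longrightarrow> nrm ((a ^^ n) x) \<le> D * nrm x" using bsym_bound[OF an] by blast
  have "nrm (a ((a ^^ n) x)) \<le> (C * D) * nrm x" if "x \<in> H" for x
    using order_trans[OF C(2)[OF bsym_mem[OF an that]] mult_left_mono[OF D(2)[OF that], of C]] C(1)
    by (simp add: mult.assoc)
  moreover have "ip (a ((a ^^ n) x)) y = ip x (a ((a ^^ n) y))" if "x \<in> H" "y \<in> H" for x y
    using that by (simp add: bsym_sym[OF a] bsym_sym[OF an] bsym_mem[OF a] bsym_mem[OF an] 
        funpow_swap1[symmetric])
  ultimately show ?case by (auto simp: bsym_def bsym_mem[OF a] bsym_mem[OF an])
qed

text \<open>The degenerate case of Cauchy-Schwarz for the semidefinite form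
  \<open>Re (ip (a x) x)\<close>: along \<open>y + \<tau> a y\<close> it equals 2 \<tau> |a y|^2
  plus a multiple of \<tau>^2, and nonnegativity for all real \<tau> makes the linear term
  vanish.\<close>

lemma bsym_nonneg_kernel:
  assumes a: "bsym a" and pos: "\<And>x. x \<in> H \<Longrightarrow> 0 \<le> Re (ip (a x) x)"
    and y: "y \<in> H" "Re (ip (a y) y) = 0"
  shows "a y = 0"
proof -
  let ?b = "(nrm (a y))\<^sup>2" and ?c = "Re (ip (a (a y)) (a y))"
  note m = bsym_mem[OF a]
  have c: "?c \<ge> 0" using pos[of "a y"] y m by simp
  have quad: "0 \<le> 2 * \<tau> * ?b + \<tau>\<^sup>2 * ?c" for \<tau> :: real
  proof -
    have "0 \<le> Re (ip (a (y + sc (of_real \<tau>) (a y))) (y + sc (of_real \<tau>) (a y)))"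
      using pos y m by simp
    also have "\<dots> = 2 * \<tau> * ?b + \<tau>\<^sup>2 * ?c"
      using y m 
      by (simp add: bsym_add[OF a] bsym_sc[OF a] ip_simps bsym_sym[OF a, of "a y" y] nrm_sq[unfolded power2_eq_square]
          power2_eq_square algebra_simps)
    finally show ?thesis .
  qed
  have "b = 0" if "b \<ge> 0" "c \<ge> 0" "\<And>\<tau>. 0 \<le> 2 * \<tau> * b + \<tau>\<^sup>2 * c" for b c :: real
  proof (rule ccontr)
    assume "b \<noteq> 0"
    with that have b: "b > 0" by simp
    \<comment> \<open>The test value is \<tau> = -s. The summand 1 avoids division by zero and gives
      \<open>s * c \<le> b\<close>, against \<open>2 * b \<le> s * c\<close>.\<close>
    define s where "s = b / (c + 1)"
    have s: "s > 0" using b that(2) by (simp add: s_def)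
    have "0 \<le> s * (s * c - 2 * b)"
      using that(3)[of "- s"] by (simp add: power2_eq_square algebra_simps)
    then have "2 * b \<le> s * c" using s by (simp add: zero_le_mult_iff)
    also have "s * c \<le> b" using b that(2) by (simp add: s_def field_simps)
    finally show False using b by simp
  qed
  then have "?b = 0" using quad c by (metis zero_le_power2)
  then show ?thesis using nrm_eq_0 m y by simp
qed

text \<open>
  The commutator \<open>c\<close> of \<open>a\<close> and \<open>t\<close> anticommutes with \<open>a\<close>. For small \<open>\<epsilon>\<close>, the map
  \<open>1 + \<epsilon> c\<^sup>2\<close> is a contraction since \<open>c\<close> is skew-symmetric; on the other hand, \<open>c\<close> is symmetric
  in the form \<open>\<langle>a\<cdot>,\<cdot>\<rangle>\<close>, so that the powers of \<open>1 + \<epsilon> c\<^sup>2\<close> increase this form at least linearly.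
\<close>

lemma commutes_if_commutes_square:
  assumes a: "bsym a" and pos: "\<And>x. x \<in> H \<Longrightarrow> 0 \<le> Re (ip (a x) x)"
    and inj: "\<And>x. x \<in> H \<Longrightarrow> a x = 0 \<Longrightarrow> x = 0"
    and t: "bsym t" and comm: "\<And>x. x \<in> H \<Longrightarrow> a (a (t x)) = t (a (a x))"
    and x: "x \<in> H"
  shows "a (t x) = t (a x)"
proof -
  note am = bsym_mem[OF a] and tm = bsym_mem[OF t]
  note alin = bsym_add[OF a] bsym_diff[OF a] bsym_sc[OF a]
  note tlin = bsym_add[OF t] bsym_diff[OF t] bsym_sc[OF t]
  define c where "c x = a (t x) - t (a x)" for x
  have cm: "c y \<in> H" if "y \<in> H" for y using that by (simp add: c_def am tm)
  have c_add: "c (y + w) = c y + c w" if "y \<in> H" "w \<in> H" for y w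
    using that by (simp add: c_def am tm alin tlin)
  have c_sc: "c (sc \<tau> y) = sc \<tau> (c y)" if "y \<in> H" for y \<tau>
    using that by (simp add: c_def am tm alin tlin scale_right_diff_distrib)
  have skew: "ip (c y) w = - ip y (c w)" if "y \<in> H" "w \<in> H" for y w
    using that by (simp add: c_def am tm ip_simps bsym_sym[OF a] bsym_sym[OF t])
  \<comment> \<open>Both sides contain \<open>- a (t (a y))\<close>; the remaining terms
    \<open>a (a (t y))\<close> and \<open>t (a (a y))\<close> agree by \<open>comm\<close>.\<close>
  have anti: "a (c y) = - c (a y)" if "y \<in> H" for y
    using that comm[OF that] by (simp add: c_def am tm alin)
  obtain Ca where Ca: "Ca > 0" "\<And>x. x \<in> H \<Longrightarrow> nrm (a x) \<le> Ca * nrm x" using bsym_bound[OF a] by blast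
  obtain Ct where Ct: "Ct > 0" "\<And>x. x \<in> H \<Longrightarrow> nrm (t x) \<le> Ct * nrm x" using bsym_bound[OF t] by blast
  define D where "D = 2 * Ca * Ct"
  have D: "D > 0" using Ca Ct by (simp add: D_def)
  have cb: "nrm (c y) \<le> D * nrm y" if y: "y \<in> H" for y
  proof -
    have "nrm (c y) \<le> nrm (a (t y)) + nrm (t (a y))"
      using nrm_add[of "a (t y)" "- t (a y)"] nrm_neg[of "t (a y)"] y by (simp add: c_def am tm)
    also have "\<dots> \<le> Ca * (Ct * nrm y) + Ct * (Ca * nrm y)"
      by (intro add_mono order_trans[OF Ca(2)] order_trans[OF Ct(2)] mult_left_mono)
        (use y Ca Ct am tm in \<open>auto intro: less_imp_le\<close>)
    finally show ?thesis by (simp add: D_def algebra_simps)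
  qed
  \<comment> \<open>As \<open>D\<close> bounds \<open>c\<close>, the term quadratic in \<epsilon> in
    the squared norm of \<open>K y\<close> is at most half of the negative linear one.\<close>
  define \<epsilon> where "\<epsilon> = 1 / D\<^sup>2"
  have e: "\<epsilon> > 0" using D by (simp add: \<epsilon>_def)
  have ecb: "\<epsilon> * (nrm (c y))\<^sup>2 \<le> (nrm y)\<^sup>2" if y: "y \<in> H" for y
    using power_mono[OF cb[OF y], of 2] D y cm
    by (simp add: \<epsilon>_def nrm_nonneg power_mult_distrib field_simps)
  define K where "K y = y + sc (of_real \<epsilon>) (c (c y))" for y
  have Km: "K y \<in> H" if "y \<in> H" for y using that by (simp add: K_def cm)
  have K_contr: "(nrm (K y))\<^sup>2 \<le> (nrm y)\<^sup>2" if y: "y \<in> H" for y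
  proof -
    have "Re (ip y (c (c y))) = - (nrm (c y))\<^sup>2"
      using skew[of y "c y"] y cm by (simp add: nrm_sq)
    then have "(nrm (K y))\<^sup>2 = (nrm y)\<^sup>2 - 2 * \<epsilon> * (nrm (c y))\<^sup>2 + \<epsilon>\<^sup>2 * (nrm (c (c y)))\<^sup>2"
      using y cm e by (simp add: K_def nrm_add_sq ip_simps nrm_sc power_mult_distrib)
    also have "\<dots> \<le> (nrm y)\<^sup>2 - 2 * \<epsilon> * (nrm (c y))\<^sup>2 + \<epsilon> * (nrm (c y))\<^sup>2"
      using mult_left_mono[OF ecb[OF cm[OF y]], of \<epsilon>] e by (simp add: power2_eq_square[of \<epsilon>] mult.assoc)
    also have "\<dots> \<le> (nrm y)\<^sup>2" using e by simp
    finally show ?thesis .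
  qed
  define q where "q y = Re (ip (a y) y)" for y
  have qpos: "q y \<ge> 0" if "y \<in> H" for y using pos that by (simp add: q_def)
  \<comment> \<open>The cross term becomes \<open>q (c y)\<close> by moving one \<open>c\<close>
    across the scalar product and then past \<open>a\<close>; skewness and anticommutation each
    contribute a sign, and the two cancel.\<close>
  have qK: "q (K y) \<ge> q y + 2 * \<epsilon> * q (c y)" if y: "y \<in> H" for y
  proof -
    have form: "ip (a y) (c (c y)) = ip (a (c y)) (c y)"
      using skew[of "a y" "c y"] y am cm by (simp add: anti ip_neg_left)
    have form': "Re (ip (a (c (c y))) y) = Re (ip (a (c y)) (c y))"
      using form y am cm by (metis bsym_sym[OF a] Re_ip_commute)
    have "q (K y) = q y + 2 * \<epsilon> * q (c y) + \<epsilon>\<^sup>2 * q (c (c y))"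
      using y cm am form form'
      by (simp add: q_def K_def alin ip_simps power2_eq_square algebra_simps)
    then show ?thesis using qpos[of "c (c y)"] y cm by simp
  qed
  have Kn: "(K ^^ n) y \<in> H" if "y \<in> H" for y n by (induction n) (use that Km in auto)
  have Kn_contr: "(nrm ((K ^^ n) y))\<^sup>2 \<le> (nrm y)\<^sup>2" if "y \<in> H" for y n
    by (induction n) (use that Kn K_contr in \<open>auto intro: order_trans\<close>)
  have cK: "c (K y) = K (c y)" if "y \<in> H" for y
    using that by (simp add: K_def c_add c_sc cm)
  have cKn: "c ((K ^^ n) y) = (K ^^ n) (c y)" if "y \<in> H" for y n
    by (induction n) (use that Kn cK in auto)
  have qKn0: "q ((K ^^ n) y) \<ge> q y" if "y \<in> H" for y n
  proof (induction n)
    case (Suc n)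
    then show ?case using qK[OF Kn[OF that, of n]] qpos[of "c ((K ^^ n) y)"] Kn[OF that, of n] cm e
      by (smt (verit) funpow.simps(2) comp_apply mult_nonneg_nonneg)
  qed simp
  \<comment> \<open>\<open>K\<close> commutes with \<open>c\<close>, so every further application of
    \<open>K\<close> adds at least \<open>2 * \<epsilon> * q (c x)\<close>.\<close>
  have qKn: "q ((K ^^ n) x) \<ge> 2 * \<epsilon> * real n * q (c x)" for n
  proof (induction n)
    case 0
    then show ?case using qpos x by simp
  next
    case (Suc n)
    have "q (c ((K ^^ n) x)) \<ge> q (c x)" using qKn0[of "c x" n] cKn[OF x] cm x by simp
    then have "2 * \<epsilon> * q (c ((K ^^ n) x)) \<ge> 2 * \<epsilon> * q (c x)" using e by simp
    then show ?case using qK[OF Kn[OF x, of n]] Suc by (simp add: algebra_simps)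
  qed
  have upper: "q ((K ^^ n) x) \<le> Ca * (nrm x)\<^sup>2" for n
  proof -
    let ?y = "(K ^^ n) x"
    have y: "?y \<in> H" using Kn x by simp
    have "q ?y \<le> nrm (a ?y) * nrm ?y"
      using cauchy_schwarz[of "a ?y" ?y] complex_Re_le_cmod[of "ip (a ?y) ?y"] y am
      by (simp add: q_def)
    also have "\<dots> \<le> Ca * nrm ?y * nrm ?y"
      using Ca(2)[OF y] nrm_nonneg[OF y] by (simp add: mult_right_mono)
    also have "\<dots> \<le> Ca * (nrm x)\<^sup>2"
      using Kn_contr[OF x, of n] Ca(1) by (simp add: power2_eq_square)
    finally show ?thesis .
  qed
  have "q (c x) = 0"
  proof (rule ccontr)
    assume "q (c x) \<noteq> 0"
    then have p: "2 * \<epsilon> * q (c x) > 0" using qpos[OF cm[OF x]] e by simp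
    obtain n where "Ca * (nrm x)\<^sup>2 < real n * (2 * \<epsilon> * q (c x))"
      using ex_less_of_nat_mult[OF p] by blast
    then show False using qKn[of n] upper[of n] by (simp add: algebra_simps)
  qed
  then have "a (c x) = 0"
    by (intro bsym_nonneg_kernel[OF a pos]) (use x cm in \<open>auto simp: q_def\<close>)
  then have "c x = 0" using inj cm x by simp
  then show ?thesis by (simp add: c_def)
qed

text \<open>With \<open>K = 1 - \<epsilon> a\<^sup>2\<close>, the difference \<open>x - K\<^sup>n x\<close> lies in the range of \<open>a\<close>, and \<open>K\<^sup>2\<^sup>n x\<close>
  tends to an element of the kernel of \<open>a\<close>.\<close>

lemma dense_range_bsym:
  assumes a: "bsym a" and inj: "\<And>x. x \<in> H \<Longrightarrow> a x = 0 \<Longrightarrow> x = 0"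
    and x: "x \<in> H" and e: "e > 0"
  shows "\<exists>y\<in>H. nrm (x - a y) < e"
proof -
  note am = bsym_mem[OF a]
  note alin = bsym_add[OF a] bsym_diff[OF a] bsym_sc[OF a]
  obtain C where C: "C > 0" "\<And>x. x \<in> H \<Longrightarrow> nrm (a x) \<le> C * nrm x" using bsym_bound[OF a] by blast
  define \<epsilon> where "\<epsilon> = 1 / C\<^sup>2"
  have ep: "\<epsilon> > 0" using C by (simp add: \<epsilon>_def)
  have eb: "\<epsilon> * (nrm (a y))\<^sup>2 \<le> (nrm y)\<^sup>2" if y: "y \<in> H" for y
    using power_mono[OF C(2)[OF y], of 2] C y am
    by (simp add: \<epsilon>_def nrm_nonneg power_mult_distrib field_simps)
  define K where "K y = y - sc (of_real \<epsilon>) (a (a y))" for y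
  have Km: "K y \<in> H" if "y \<in> H" for y using that by (simp add: K_def am)
  have K_contr: "(nrm (K y))\<^sup>2 \<le> (nrm y)\<^sup>2 - \<epsilon> * (nrm (a y))\<^sup>2" if y: "y \<in> H" for y
  proof -
    have "Re (ip y (a (a y))) = (nrm (a y))\<^sup>2"
      using bsym_sym[OF a, of y "a y"] y am by (simp add: nrm_sq)
    then have "(nrm (K y))\<^sup>2 = (nrm y)\<^sup>2 - 2 * \<epsilon> * (nrm (a y))\<^sup>2 + \<epsilon>\<^sup>2 * (nrm (a (a y)))\<^sup>2"
      using y am ep by (simp add: K_def nrm_diff_sq ip_simps nrm_sc power_mult_distrib)
    also have "\<dots> \<le> (nrm y)\<^sup>2 - 2 * \<epsilon> * (nrm (a y))\<^sup>2 + \<epsilon> * (nrm (a y))\<^sup>2"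
      using mult_left_mono[OF eb[OF am[OF y]], of \<epsilon>] ep by (simp add: power2_eq_square[of \<epsilon>] mult.assoc)
    finally show ?thesis by simp
  qed
  have K_sym: "ip (K y) w = ip y (K w)" if "y \<in> H" "w \<in> H" for y w
    using that by (simp add: K_def am ip_simps bsym_sym[OF a])
  have Kn: "(K ^^ n) y \<in> H" if "y \<in> H" for y n by (induction n) (use that Km in auto)
  have Kn_sym: "ip ((K ^^ n) y) w = ip y ((K ^^ n) w)" if "y \<in> H" "w \<in> H" for y w n
    using that 
    by (induction n arbitrary: y w) (simp_all add: K_sym Km Kn funpow_swap1)
  define \<rho> where "\<rho> k = (nrm ((K ^^ k) x))\<^sup>2" for k
  have \<rho>_Suc: "\<rho> (Suc k) \<le> \<rho> k - \<epsilon> * (nrm (a ((K ^^ k) x)))\<^sup>2" for k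
    using K_contr[OF Kn[OF x]] by (simp add: \<rho>_def)
  have "decseq \<rho>"
    using \<rho>_Suc ep by (intro decseq_SucI) (smt (verit) mult_nonneg_nonneg zero_le_power2)
  then obtain r where r: "\<rho> \<longlonglongrightarrow> r"
    using decseq_convergent[of \<rho> 0] by (auto simp: \<rho>_def)
  \<comment> \<open>Even powers make the real part of \<open>ip (y n) (y k)\<close> equal to
    \<open>\<rho> (n + k)\<close>, by symmetry of \<open>K\<close>. Squared distances are then
    combinations of values of the convergent sequence \<open>\<rho>\<close>, so that
    \<open>y\<close> is Cauchy.\<close>
  define y where "y n = (K ^^ (2 * n)) x" for n
  have ym: "y n \<in> H" for n using Kn x by (simp add: y_def)
  have ip_y: "Re (ip (y n) (y k)) = \<rho> (n + k)" for n k
  proof -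
    have "ip (y n) (y k) = ip x ((K ^^ (2 * n + 2 * k)) x)"
      using Kn_sym[OF x Kn[OF x]] by (simp add: y_def funpow_add)
    also have "2 * n + 2 * k = (n + k) + (n + k)" by simp
    also have "ip x ((K ^^ ((n + k) + (n + k))) x) = ip ((K ^^ (n + k)) x) ((K ^^ (n + k)) x)"
      using Kn_sym[OF x Kn[OF x], of "n + k" "n + k"] funpow_add[of "n + k" "n + k" K] by simp
    finally show ?thesis using Kn x by (simp add: \<rho>_def nrm_sq)
  qed
  have dist_y: "(nrm (y n - y k))\<^sup>2 = \<rho> (n + n) - 2 * \<rho> (n + k) + \<rho> (k + k)" for n k
    unfolding nrm_diff_sq[OF ym ym] using ip_y[of n n] ip_y[of n k] ip_y[of k k] ym by (simp add: nrm_sq)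
  obtain v where v: "v \<in> H" "(\<lambda>n. nrm (y n - v)) \<longlonglongrightarrow> 0"
  proof -
    have "\<exists>N. \<forall>k\<ge>N. \<forall>l\<ge>N. nrm (y k - y l) < \<delta>" if \<delta>: "\<delta> > 0" for \<delta> :: real
    proof -
      have "\<delta>\<^sup>2 / 4 > 0" using \<delta> by simp
      \<comment> \<open>The coefficients 1, -2, 1 in \<open>dist_y\<close> cancel the limit
        \<open>r\<close> and let at most four errors add up.\<close>
      then obtain N where N: "\<And>n. n \<ge> N \<Longrightarrow> \<bar>\<rho> n - r\<bar> < \<delta>\<^sup>2 / 4"
        using LIMSEQ_D[OF r] by (metis real_norm_def)
      have "nrm (y k - y l) < \<delta>" if "k \<ge> N" "l \<ge> N" for k l
      proof -
        have "(nrm (y k - y l))\<^sup>2 < \<delta>\<^sup>2"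
          unfolding dist_y using N[of "k + k"] N[of "k + l"] N[of "l + l"] that by (simp add: abs_if split: if_splits)
        then show ?thesis using \<delta> by (simp add: power2_less_imp_less)
      qed
      then show ?thesis by blast
    qed
    then show ?thesis using complete[of y] ym that by blast
  qed
  \<comment> \<open>One step decreases \<open>\<rho>\<close> by at least \<epsilon> times the
    squared norm of \<open>a (y n)\<close>. These decreases tend to 0, so the limit of
    \<open>y\<close> lies in the kernel of \<open>a\<close>.\<close>
  have "(\<lambda>n. (\<rho> (2 * n) - \<rho> (Suc (2 * n))) / \<epsilon>) \<longlonglongrightarrow> (r - r) / \<epsilon>"
    by (intro tendsto_intros filterlim_compose[OF r])
      (use ep in \<open>auto intro!: filterlim_subseq strict_monoI\<close>)
  then have lim: "(\<lambda>n. (\<rho> (2 * n) - \<rho> (Suc (2 * n))) / \<epsilon>) \<longlonglongrightarrow> 0" by simp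
  have "(\<lambda>n. (nrm (a (y n)))\<^sup>2) \<longlonglongrightarrow> 0"
  proof (rule tendsto_sandwich[OF _ _ tendsto_const lim])
    have "(nrm (a (y n)))\<^sup>2 \<le> (\<rho> (2 * n) - \<rho> (Suc (2 * n))) / \<epsilon>" for n
      using \<rho>_Suc[of "2 * n"] ep by (simp add: y_def field_simps)
    then show "\<forall>\<^sub>F n in sequentially. (nrm (a (y n)))\<^sup>2 \<le> (\<rho> (2 * n) - \<rho> (Suc (2 * n))) / \<epsilon>"
      by simp
  qed simp
  then have "(\<lambda>n. sqrt ((nrm (a (y n)))\<^sup>2)) \<longlonglongrightarrow> sqrt 0" by (rule tendsto_real_sqrt)
  then have lim1: "(\<lambda>n. nrm (a (y n) - 0)) \<longlonglongrightarrow> 0" using ym am by (simp add: nrm_nonneg)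
  have lim2: "(\<lambda>n. nrm (a (y n) - a v)) \<longlonglongrightarrow> 0"
  proof (rule tendsto_sandwich[of "\<lambda>n. 0"])
    show "\<forall>\<^sub>F n in sequentially. nrm (a (y n) - a v) \<le> C * nrm (y n - v)"
      using C(2)[OF mem_diff[OF ym v(1)]] ym v(1) by (simp add: alin)
    show "(\<lambda>n. C * nrm (y n - v)) \<longlonglongrightarrow> 0" using tendsto_mult_right_zero[OF v(2)] .
  qed (use ym v am in \<open>auto intro!: always_eventually nrm_nonneg\<close>)
  have "a v = 0" using limit_unique[OF _ _ _ lim2 lim1] ym v am by simp
  then have "v = 0" using inj v by simp
  then obtain n where n: "nrm (y n) < e"
    using order_tendstoD(2)[OF v(2) e] by (auto simp: eventually_sequentially)
  have "\<exists>w\<in>H. x - (K ^^ k) x = a w" for k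
  proof (induction k)
    case 0
    then show ?case by (auto intro!: bexI[of _ 0] simp: bsym_0[OF a])
  next
    case (Suc k)
    then obtain w where w: "w \<in> H" "x - (K ^^ k) x = a w" by blast
    let ?u = "sc (of_real \<epsilon>) (a ((K ^^ k) x))"
    have "x - (K ^^ Suc k) x = a w + sc (of_real \<epsilon>) (a (a ((K ^^ k) x)))"
      using w(2) by (simp add: K_def algebra_simps)
    also have "\<dots> = a (w + ?u)" using w Kn[OF x] am by (simp add: alin)
    finally show ?case using w Kn[OF x, of k] am by (metis mem_add mem_sc)
  qed
  then obtain w where "w \<in> H" "x - y n = a w" unfolding y_def by blast
  moreover then have "x - a w = y n" by (simp add: algebra_simps)
  ultimately show ?thesis using n by metis
qed

text \<open>Unbounded operators are handled through their bounded inverses, hence the graphs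
  \<open>{(b x, x)}\<close>. Since \<open>A O A\<close> has range \<open>H\<close>, so has
  \<open>A\<close>; a symmetric relation with full range is injective, so \<open>A\<close> is the
  inverse of a map \<open>a\<close>, and |a x|^2 = Re <x, b x> bounds it.\<close>

lemma inverse_of_nonneg_sqrt:
  assumes B: "B = {(b x, x) | x. x \<in> H}" and A: "nonneg_sqrt H ip B A"
    and b: "bsym b"
  obtains a where "A = {(a x, x) | x. x \<in> H}" "bsym a" "\<And>x. x \<in> H \<Longrightarrow> 0 \<le> Re (ip (a x) x)"
    "\<And>x. x \<in> H \<Longrightarrow> a (a x) = b x"
proof -
  have sv: "single_valued A" and adj: "adjoint_rel H ip A = A" and AA: "A O A = B"
    and pos: "\<And>f f'. (f, f') \<in> A \<Longrightarrow> 0 \<le> Re (ip f f')"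
    using A by (auto simp: nonneg_sqrt_def self_adjoint_op_def)
  have AH: "f \<in> H \<and> f' \<in> H" if "(f, f') \<in> A" for f f'
    using that adj by (auto simp: adjoint_rel_def)
  have sym: "ip f g' = ip f' g" if "(f, f') \<in> A" "(g, g') \<in> A" for f f' g g'
    using that adj unfolding adjoint_rel_def by fastforce
  have surj: "\<exists>f. (f, x) \<in> A" if "x \<in> H" for x
  proof -
    have "(b x, x) \<in> A O A" using that AA B by blast
    then show ?thesis by blast
  qed
  have inj: "f = g" if "(f, x) \<in> A" "(g, x) \<in> A" for f g x
  proof (rule eq_if_ip_eq)
    fix w assume "w \<in> H"
    then obtain h where "(h, w) \<in> A" using surj by blast
    then show "ip f w = ip g w" using sym that by metis
  qed (use that AH in auto)
  define a where "a x = (THE f. (f, x) \<in> A)" for x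
  have a: "(a x, x) \<in> A" if x: "x \<in> H" for x
    unfolding a_def using surj[OF x] inj by (metis theI)
  have am: "a x \<in> H" if "x \<in> H" for x using a AH that by blast
  have A_eq: "A = {(a x, x) | x. x \<in> H}"
  proof (intro set_eqI iffI)
    fix p assume "p \<in> A"
    moreover obtain f x where p: "p = (f, x)" by (cases p)
    ultimately have fx: "(f, x) \<in> A" by simp
    then have x: "x \<in> H" using AH by blast
    have "f = a x" by (rule inj[OF fx a[OF x]])
    then show "p \<in> {(a x, x) | x. x \<in> H}" using p x by blast
  qed (use a in auto)
  have asym: "ip (a x) y = ip x (a y)" if "x \<in> H" "y \<in> H" for x y
    using sym[OF a a] that by blast
  have aa: "a (a x) = b x" if "x \<in> H" for x
  proof -
    have "(a (a x), x) \<in> A O A" using a[OF that] a[OF am[OF that]] by blast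
    then show ?thesis using AA B by auto
  qed
  have apos: "0 \<le> Re (ip (a x) x)" if "x \<in> H" for x using pos[OF a[OF that]] .
  obtain C where C: "C > 0" "\<And>x. x \<in> H \<Longrightarrow> nrm (b x) \<le> C * nrm x" using bsym_bound[OF b] by blast
  have "nrm (a x) \<le> sqrt C * nrm x" if x: "x \<in> H" for x
  proof -
    have "(nrm (a x))\<^sup>2 = Re (ip x (b x))"
      using asym[of x "a x"] x am aa by (simp add: nrm_sq)
    also have "\<dots> \<le> nrm x * nrm (b x)"
      using cauchy_schwarz[of x "b x"] complex_Re_le_cmod[of "ip x (b x)"] x bsym_mem[OF b] by simp
    also have "\<dots> \<le> nrm x * (C * nrm x)"
      using C(2)[OF x] nrm_nonneg[OF x] by (simp add: mult_left_mono)
    also have "\<dots> = (sqrt C * nrm x)\<^sup>2" using C(1) by (simp add: power_mult_distrib power2_eq_square)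
    finally show ?thesis by (rule power2_le_imp_le) (use C(1) nrm_nonneg[OF x] in simp)
  qed
  then have "bsym a" unfolding bsym_def using am asym by blast
  then show ?thesis by (rule that[OF A_eq _ apos aa])
qed

end

section \<open>The shifted operator on the scale\<close>

locale scale =
  fixes X :: "('v::ab_group_add, 'x) scale_data_scheme"
  assumes hscale: "hilbert_scale X"
begin

sublocale vector_space "scl X"
  using hscale by (simp add: hilbert_scale_def)

sublocale H: hilbert_carrier "scl X" "space\<^sub>H X n" "ip\<^sub>H X n" for n
  using hscale by unfold_locales (simp add: hilbert_scale_def)

sublocale L: Vector_Spaces.linear "scl X" "scl X" "opL X"
  using hscale by (simp add: hilbert_scale_def)

lemma opL_bounds:
  "\<exists>C. \<forall>u\<in>space\<^sub>H X (n + 1). norm\<^sub>H X n u \<le> C * norm\<^sub>H X (n + 1) u"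
  "\<exists>C. \<forall>u\<in>space\<^sub>H X (n + 2). norm\<^sub>H X n (opL X u) \<le> C * norm\<^sub>H X (n + 2) u"
  using hscale by (simp_all add: hilbert_scale_def)

abbreviation Sp :: "int \<Rightarrow> 'v set" where "Sp \<equiv> space\<^sub>H X"
abbreviation N :: "int \<Rightarrow> 'v \<Rightarrow> real" where "N n \<equiv> ip_norm (ip\<^sub>H X n)"
abbreviation z1 :: complex where "z1 \<equiv> of_real (zpar X)"

section \<open>Elementary mapping properties of L - z on the scale\<close>

definition Lz :: "complex \<Rightarrow> 'v \<Rightarrow> 'v" where "Lz z u = opL X u - scl X z u"

abbreviation T :: "'v \<Rightarrow> 'v" where "T \<equiv> Lz z1"

lemma Lz_add: "Lz z (u + v) = Lz z u + Lz z v"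
  and Lz_diff: "Lz z (u - v) = Lz z u - Lz z v"
  and Lz_scl: "Lz z (scl X a u) = scl X a (Lz z u)"
  and Lz_0 [simp]: "Lz z 0 = 0"
  by (simp_all add: Lz_def L.add L.diff L.scale scale_right_distrib scale_right_diff_distrib
      algebra_simps)

lemma Lz_shift: "Lz z u = T u - scl X (z - z1) u"
  unfolding Lz_def scale_left_diff_distrib by (simp only: diff_diff_eq2 diff_add_cancel)

lemma Sp_mono: "i \<le> j \<Longrightarrow> Sp j \<subseteq> Sp i"
proof (induction j rule: int_ge_induct)
  case (step j)
  have "Sp (j + 1) \<subseteq> Sp j" using hscale by (simp add: hilbert_scale_def)
  then show ?case using step by simp
qed simp

lemma Sp_mem: "u \<in> Sp j \<Longrightarrow> i \<le> j \<Longrightarrow> u \<in> Sp i"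
  using Sp_mono by blast

lemma opL_mem: "u \<in> Sp (n + 2) \<Longrightarrow> opL X u \<in> Sp n"
  using hscale by (simp add: hilbert_scale_def image_subset_iff)

lemma Lz_mem: "u \<in> Sp (n + 2) \<Longrightarrow> Lz z u \<in> Sp n"
  using opL_mem[of u n] Sp_mem[of u "n + 2" n] by (simp add: Lz_def)

lemma N_step: "\<exists>C\<ge>0. \<forall>u\<in>Sp (n + 1). N n u \<le> C * N (n + 1) u"
proof -
  obtain C where C: "\<forall>u\<in>Sp (n + 1). N n u \<le> C * N (n + 1) u"
    using opL_bounds(1)[of n] by (auto simp: norm\<^sub>H_def)
  have "\<forall>u\<in>Sp (n + 1). N n u \<le> max 0 C * N (n + 1) u"
    using C H.nrm_nonneg by (smt (verit) mult_right_mono max.cobounded2)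
  then show ?thesis by (meson max.cobounded1)
qed

lemma N_mono:
  assumes "i \<le> j" shows "\<exists>C\<ge>0. \<forall>u\<in>Sp j. N i u \<le> C * N j u"
  using assms
proof (induction j rule: int_ge_induct)
  case base
  show ?case by (intro exI[of _ 1]) simp
next
  case (step j)
  obtain C where C: "C \<ge> 0" "\<forall>u\<in>Sp j. N i u \<le> C * N j u" using step by blast
  obtain D where D: "D \<ge> 0" "\<forall>u\<in>Sp (j + 1). N j u \<le> D * N (j + 1) u" using N_step by blast
  have "N i u \<le> (C * D) * N (j + 1) u" if "u \<in> Sp (j + 1)" for u
  proof -
    have "N i u \<le> C * N j u" using C(2) Sp_mem[OF that, of j] by simp
    also have "\<dots> \<le> C * (D * N (j + 1) u)" using C(1) D(2) that by (simp add: mult_left_mono)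
    finally show ?thesis by (simp add: mult.assoc)
  qed
  then show ?case using C(1) D(1) by (intro exI[of _ "C * D"]) simp
qed

lemma Lz_bound: "\<exists>C. \<forall>u\<in>Sp (n + 2). N n (Lz z u) \<le> C * N (n + 2) u"
proof -
  obtain C where C: "\<forall>u\<in>Sp (n + 2). N n (opL X u) \<le> C * N (n + 2) u"
    using opL_bounds(2)[of n] by (auto simp: norm\<^sub>H_def)
  obtain D where D: "\<forall>u\<in>Sp (n + 2). N n u \<le> D * N (n + 2) u" using N_mono[of n "n + 2"] by auto
  have "N n (Lz z u) \<le> (C + cmod z * D) * N (n + 2) u" if u: "u \<in> Sp (n + 2)" for u
  proof -
    have u': "u \<in> Sp n" using Sp_mem[OF u, of n] by simp
    have "N n (Lz z u) \<le> N n (opL X u) + N n (scl X z u)"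
      using H.nrm_add[of "opL X u" n "- scl X z u"] H.nrm_neg[of "scl X z u" n] u' opL_mem[OF u]
      by (simp add: Lz_def)
    also have "\<dots> \<le> C * N (n + 2) u + cmod z * (D * N (n + 2) u)"
      using C D u H.nrm_sc[OF u'] by (auto intro!: add_mono mult_left_mono)
    finally show ?thesis by (simp add: algebra_simps)
  qed
  then show ?thesis by blast
qed

lemma tendsto_Lz:
  assumes "\<And>k::nat. u k \<in> Sp (n + 2)" "v \<in> Sp (n + 2)" "(\<lambda>k. N (n + 2) (u k - v)) \<longlonglongrightarrow> 0"
  shows "(\<lambda>k. N n (Lz z (u k) - Lz z v)) \<longlonglongrightarrow> 0"
proof -
  obtain C where C: "\<forall>u\<in>Sp (n + 2). N n (Lz z u) \<le> C * N (n + 2) u" using Lz_bound by blast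
  show ?thesis
  proof (rule tendsto_sandwich[of "\<lambda>n. 0"])
    show "\<forall>\<^sub>F k in sequentially. N n (Lz z (u k) - Lz z v) \<le> C * N (n + 2) (u k - v)"
      using C assms(1,2) by (auto intro!: always_eventually simp flip: Lz_diff)
    show "(\<lambda>k. C * N (n + 2) (u k - v)) \<longlonglongrightarrow> 0" using tendsto_mult_right_zero[OF assms(3)] .
    show "\<forall>\<^sub>F k in sequentially. 0 \<le> N n (Lz z (u k) - Lz z v)"
      using assms by (intro always_eventually allI H.nrm_nonneg H.mem_diff Lz_mem)
  qed simp
qed

lemma approx_Sp0:
  assumes "n < 0" "f \<in> Sp n"
  obtains u where "\<And>k::nat. u k \<in> Sp 0" "(\<lambda>k. N n (u k - f)) \<longlonglongrightarrow> 0"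
proof -
  have "\<exists>v\<in>Sp 0. N n (f - v) < 1 / real (Suc k)" for k
    using hscale assms by (simp add: hilbert_scale_def norm\<^sub>H_def)
  then obtain u where u: "\<And>k. u k \<in> Sp 0" "\<And>k. N n (f - u k) < 1 / real (Suc k)" by metis
  have un: "u k \<in> Sp n" for k using Sp_mem[OF u(1)] assms(1) by simp
  have "(\<lambda>k. N n (u k - f)) \<longlonglongrightarrow> 0"
  proof (rule tendsto_sandwich[of "\<lambda>n. 0" _ _ "\<lambda>k. 1 / real (Suc k)"])
    show "(\<lambda>k. 1 / real (Suc k)) \<longlonglongrightarrow> 0" by (rule lim_1_over_n[THEN LIMSEQ_Suc])
    show "\<forall>\<^sub>F k in sequentially. N n (u k - f) \<le> 1 / real (Suc k)"
      using u(2) H.nrm_minus_commute[OF un assms(2)] by (auto intro!: always_eventually less_imp_le)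
    show "\<forall>\<^sub>F k in sequentially. 0 \<le> N n (u k - f)"
      using un assms by (auto intro!: always_eventually H.nrm_nonneg)
  qed simp
  then show ?thesis by (rule that[OF u(1)])
qed

lemma root_ex:
  "\<exists>S. is_sqrt_abs_shift X S \<and>
     (\<forall>n>0.
        space\<^sub>H X (int n) = Domain (S ^^ n) \<and>
        (\<forall>(u, u')\<in>S ^^ n. \<forall>(v, v')\<in>S ^^ n. ip\<^sub>H X (int n) u v = ip\<^sub>H X 0 u' v') \<and>
        (\<forall>(u', u)\<in>S ^^ n. \<forall>(v', v)\<in>S ^^ n. ip\<^sub>H X (- int n) u v = ip\<^sub>H X 0 u' v'))"
  using hscale unfolding hilbert_scale_def by (elim conjE) assumption

text \<open>\<open>t\<close> is the inverse of L - z_1 and \<open>s\<close> that of S = |L -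
  z_1|^(1/2), both bounded on \<open>Sp 0\<close>. Powers of \<open>s\<close> map
  \<open>Sp 0\<close> isometrically onto the spaces of positive order and give the norms of negative
  order on \<open>Sp 0\<close>. The maps are linked by s^4 = t^2 and not by s^2 = t, as
  \<open>t\<close> may be indefinite.\<close>

lemma inverse_and_root:
  obtains t s where "H.bsym 0 t" "H.bsym 0 s"
    "\<And>x. x \<in> Sp 0 \<Longrightarrow> t x \<in> Sp 2" "\<And>x. x \<in> Sp 0 \<Longrightarrow> T (t x) = x" "\<And>u. u \<in> Sp 2 \<Longrightarrow> t (T u) = u"
    "\<And>x. x \<in> Sp 0 \<Longrightarrow> s (t x) = t (s x)"
    "\<And>x. x \<in> Sp 0 \<Longrightarrow> s x = 0 \<Longrightarrow> x = 0"
    "\<And>x. x \<in> Sp 0 \<Longrightarrow> s (s (s (s x))) = t (t x)"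
    "\<And>n. n > 0 \<Longrightarrow> Sp (int n) = (s ^^ n) ` Sp 0"
    "\<And>n x y. n > 0 \<Longrightarrow> x \<in> Sp 0 \<Longrightarrow> y \<in> Sp 0 \<Longrightarrow>
      ip\<^sub>H X (int n) ((s ^^ n) x) ((s ^^ n) y) = ip\<^sub>H X 0 x y"
    "\<And>n x y. n > 0 \<Longrightarrow> x \<in> Sp 0 \<Longrightarrow> y \<in> Sp 0 \<Longrightarrow>
      ip\<^sub>H X (- int n) x y = ip\<^sub>H X 0 ((s ^^ n) x) ((s ^^ n) y)"
proof -
  define G where "G = graphL X 0"
  have G: "(u, v) \<in> G \<longleftrightarrow> u \<in> Sp 2 \<and> v = opL X u" for u v by (auto simp: G_def graphL_def)
  have selfadj: "adjoint_rel (Sp 0) (ip\<^sub>H X 0) G = G"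
    using hscale by (simp add: hilbert_scale_def self_adjoint_op_def G_def)
  have Sp20: "u \<in> Sp 0" if "u \<in> Sp 2" for u using Sp_mem[OF that] by simp
  have Lm: "opL X u \<in> Sp 0" if "u \<in> Sp 2" for u using opL_mem[of u 0] that by simp
  have Tm: "T u \<in> Sp 0" if "u \<in> Sp 2" for u using Lz_mem[of u 0] that by simp
  have L_sym: "ip\<^sub>H X 0 u (opL X v) = ip\<^sub>H X 0 (opL X u) v" if "u \<in> Sp 2" "v \<in> Sp 2" for u v
  proof -
    have "(u, opL X u) \<in> adjoint_rel (Sp 0) (ip\<^sub>H X 0) G" using that selfadj G by simp
    moreover have "(v, opL X v) \<in> G" using that G by simp
    ultimately show ?thesis unfolding adjoint_rel_def by fastforce
  qed
  have T_sym: "ip\<^sub>H X 0 u (T v) = ip\<^sub>H X 0 (T u) v" if "u \<in> Sp 2" "v \<in> Sp 2" for u v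
    using that L_sym[OF that] by (simp add: Lz_def H.ip_simps Sp20 Lm)
  define R where "R = shifted_inverse (scl X z1) G"
  have R: "(g, u) \<in> R \<longleftrightarrow> u \<in> Sp 2 \<and> g = T u" for g u
    by (auto simp: R_def shifted_inverse_def G Lz_def)
  have "z1 \<in> resolvent_set (scl X) (Sp 0) (N 0) G"
    using hscale by (simp add: hilbert_scale_def resL_def norm\<^sub>H_def G_def)
  then have Rsv: "single_valued R" and Rdom: "Domain R = Sp 0"
    and "\<exists>C. \<forall>(g, u)\<in>R. N 0 u \<le> C * N 0 g"
    by (auto simp: resolvent_set_def R_def)
  then obtain C where C: "\<And>g u. (g, u) \<in> R \<Longrightarrow> N 0 u \<le> C * N 0 g" by blast
  define t where "t x = (THE u. (x, u) \<in> R)" for x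
  have tR: "(x, t x) \<in> R" if x: "x \<in> Sp 0" for x
  proof -
    obtain u where u: "(x, u) \<in> R" using Rdom x by blast
    then have "t x = u" unfolding t_def using Rsv by (auto simp: single_valued_def)
    then show ?thesis using u by simp
  qed
  have t2: "t x \<in> Sp 2" and Tt: "T (t x) = x" if "x \<in> Sp 0" for x using tR[OF that] R by auto
  have tT: "t (T u) = u" if "u \<in> Sp 2" for u
    using tR[OF Tm[OF that]] R[of "T u" u] that Rsv by (auto simp: single_valued_def)
  have t: "H.bsym 0 t"
    unfolding H.bsym_def using t2 Sp20 T_sym[OF t2 t2] Tt C[OF tR] by metis
  define T2 where "T2 = {(u, opL X u - scl X z1 u) | u. u \<in> Sp 2}"
  have T2: "(u, v) \<in> T2 \<longleftrightarrow> u \<in> Sp 2 \<and> v = T u" for u v by (auto simp: T2_def Lz_def)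
  \<comment> \<open>Squaring removes the sign of L - z_1; the graph is expressed through the bounded
    map \<open>t ^^ 2\<close>, as \<open>inverse_of_nonneg_sqrt\<close> expects.\<close>
  have T2T2: "T2 O T2 = {((t ^^ 2) x, x) | x. x \<in> Sp 0}"
  proof (intro set_eqI iffI)
    fix p assume "p \<in> T2 O T2"
    then obtain u where u: "p = (u, T (T u))" "u \<in> Sp 2" "T u \<in> Sp 2" by (auto simp: T2)
    then have "p = ((t ^^ 2) (T (T u)), T (T u))" by (simp add: tT numeral_2_eq_2)
    then show "p \<in> {((t ^^ 2) x, x) | x. x \<in> Sp 0}" using Tm u by blast
  next
    fix p assume "p \<in> {((t ^^ 2) x, x) | x. x \<in> Sp 0}"
    then obtain x where x: "p = (t (t x), x)" "x \<in> Sp 0" by (auto simp: numeral_2_eq_2)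
    have "(t (t x), t x) \<in> T2" "(t x, x) \<in> T2"
      using x by (auto simp: T2 t2 Tt Sp20)
    then show "p \<in> T2 O T2" using x(1) by blast
  qed
  obtain S where S1: "is_sqrt_abs_shift X S" and S0: "\<forall>n>0.
        space\<^sub>H X (int n) = Domain (S ^^ n) \<and>
        (\<forall>(u, u')\<in>S ^^ n. \<forall>(v, v')\<in>S ^^ n. ip\<^sub>H X (int n) u v = ip\<^sub>H X 0 u' v') \<and>
        (\<forall>(u', u)\<in>S ^^ n. \<forall>(v', v)\<in>S ^^ n. ip\<^sub>H X (- int n) u v = ip\<^sub>H X 0 u' v')"
    using root_ex by (elim exE conjE)
  have S2: "Sp (int n) = Domain (S ^^ n)" if "n > 0" for n using S0 that by simp
  have S3: "ip\<^sub>H X (int n) u v = ip\<^sub>H X 0 u' v'"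
    if "n > 0" "(u, u') \<in> S ^^ n" "(v, v') \<in> S ^^ n" for n u u' v v'
  proof -
    have "\<forall>(u, u')\<in>S ^^ n. \<forall>(v, v')\<in>S ^^ n. ip\<^sub>H X (int n) u v = ip\<^sub>H X 0 u' v'"
      using S0 that(1) by simp
    from bspec[OF this that(2)] that(3) show ?thesis by auto
  qed
  have S4: "ip\<^sub>H X (- int n) u v = ip\<^sub>H X 0 u' v'"
    if "n > 0" "(u', u) \<in> S ^^ n" "(v', v) \<in> S ^^ n" for n u u' v v'
  proof -
    have "\<forall>(u', u)\<in>S ^^ n. \<forall>(v', v)\<in>S ^^ n. ip\<^sub>H X (- int n) u v = ip\<^sub>H X 0 u' v'"
      using S0 that(1) by simp
    from bspec[OF this that(2)] that(3) show ?thesis by auto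
  qed
  obtain A where A: "nonneg_sqrt (Sp 0) (ip\<^sub>H X 0) (T2 O T2) A" "nonneg_sqrt (Sp 0) (ip\<^sub>H X 0) A S"
    using S1 unfolding is_sqrt_abs_shift_def Let_def T2_def by blast
  obtain a where a: "A = {(a x, x) | x. x \<in> Sp 0}" "H.bsym 0 a"
    "\<And>x. x \<in> Sp 0 \<Longrightarrow> 0 \<le> Re (ip\<^sub>H X 0 (a x) x)" "\<And>x. x \<in> Sp 0 \<Longrightarrow> a (a x) = (t ^^ 2) x"
    by (rule H.inverse_of_nonneg_sqrt[OF T2T2 A(1) H.bsym_funpow[OF t]]) (rule that)
  obtain s where s: "S = {(s x, x) | x. x \<in> Sp 0}" "H.bsym 0 s"
    "\<And>x. x \<in> Sp 0 \<Longrightarrow> 0 \<le> Re (ip\<^sub>H X 0 (s x) x)" "\<And>x. x \<in> Sp 0 \<Longrightarrow> s (s x) = a x"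
    by (rule H.inverse_of_nonneg_sqrt[OF a(1) A(2) a(2)]) (rule that)
  note sm = H.bsym_mem[OF s(2)] and am = H.bsym_mem[OF a(2)] and tm = H.bsym_mem[OF t]
  have aa: "a (a x) = t (t x)" if "x \<in> Sp 0" for x using a(4)[OF that] by (simp add: numeral_2_eq_2)
  have t_inj: "x = 0" if "x \<in> Sp 0" "t x = 0" for x using Tt[OF that(1)] that(2) by simp
  have a_inj: "x = 0" if "x \<in> Sp 0" "a x = 0" for x
    using aa[OF that(1)] that H.bsym_0[OF a(2)] t_inj tm by metis
  have s_inj: "x = 0" if "x \<in> Sp 0" "s x = 0" for x
    using s(4)[OF that(1)] that H.bsym_0[OF s(2)] a_inj by metis
  have at: "a (t x) = t (a x)" if "x \<in> Sp 0" for x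
    by (rule H.commutes_if_commutes_square[OF a(2,3) a_inj t]) (use that aa am tm in auto)
  have st: "s (t x) = t (s x)" if "x \<in> Sp 0" for x
    by (rule H.commutes_if_commutes_square[OF s(2,3) s_inj t]) (use that s(4) at tm sm in auto)
  have Sn: "S ^^ n = {((s ^^ n) x, x) | x. x \<in> Sp 0}" if "n > 0" for n
    using that
  proof (induction n rule: nat_induct_non_zero)
    case 1
    then show ?case by (simp add: s(1))
  next
    case (Suc n)
    have "S ^^ Suc n = S ^^ n O S" by simp
    also have "\<dots> = {((s ^^ Suc n) x, x) | x. x \<in> Sp 0}"
    proof (intro set_eqI iffI)
      fix p assume "p \<in> {((s ^^ Suc n) x, x) | x. x \<in> Sp 0}"
      then obtain x where x: "p = ((s ^^ n) (s x), x)" "x \<in> Sp 0"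
        by (auto simp: funpow_swap1)
      have "((s ^^ n) (s x), s x) \<in> S ^^ n" "(s x, x) \<in> S"
        using Suc x(2) sm s(1) by auto
      then show "p \<in> S ^^ n O S" using x(1) by blast
    next
      fix p assume "p \<in> S ^^ n O S"
      then obtain f y x where "p = (f, x)" "(f, y) \<in> S ^^ n" "(y, x) \<in> S" by blast
      moreover then have "f = (s ^^ n) y" "y = s x" "x \<in> Sp 0" using Suc(2) s(1) by auto
      ultimately show "p \<in> {((s ^^ Suc n) x, x) | x. x \<in> Sp 0}" by (auto simp: funpow_swap1)
    qed
    finally show ?case .
  qed
  show ?thesis
  proof (rule that[OF t s(2) t2 Tt tT st s_inj])
    fix n :: nat and x y assume n: "n > 0"
    show "Sp (int n) = (s ^^ n) ` Sp 0" using S2[OF n] Sn[OF n] by auto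
    assume "x \<in> Sp 0" "y \<in> Sp 0"
    then have xy: "((s ^^ n) x, x) \<in> S ^^ n" "((s ^^ n) y, y) \<in> S ^^ n"
      using Sn[OF n] by auto
    show "ip\<^sub>H X (int n) ((s ^^ n) x) ((s ^^ n) y) = ip\<^sub>H X 0 x y"
      "ip\<^sub>H X (- int n) x y = ip\<^sub>H X 0 ((s ^^ n) x) ((s ^^ n) y)"
      using S3[OF n xy] S4[OF n xy] by auto
  qed (use s(4) aa sm am in auto)
qed


section \<open>Isometry and bijectivity of L - z_1 between spaces two orders apart\<close>

lemma funpow_closed: "(\<And>x. x \<in> A \<Longrightarrow> f x \<in> A) \<Longrightarrow> x \<in> A \<Longrightarrow> (f ^^ n) x \<in> A"
  by (induction n) auto

lemma N_eqI: "ip\<^sub>H X i u u = ip\<^sub>H X j v v \<Longrightarrow> N i u = N j v"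
  by (simp add: ip_norm_def)

text \<open>As t^2 = s^4, the vectors \<open>t v\<close> and \<open>s (s v)\<close> have the same
  norm in \<open>Sp 0\<close>; powers of \<open>s\<close>, which commute with \<open>t\<close>,
  carry this to other orders. For \<open>u\<close> in \<open>Sp 2\<close> the image
  \<open>T u\<close> lies in \<open>Sp 0\<close>, where the norms of negative order are
  explicit.\<close>

lemma T_isometric:
  assumes u2: "u \<in> Sp 2" and k: "k > 0"
  shows "N (- int k) (T u) = N (2 - int k) u"
proof -
  obtain t s where t: "H.bsym 0 t" and s: "H.bsym 0 s"
    and t2: "\<And>x. x \<in> Sp 0 \<Longrightarrow> t x \<in> Sp 2" and Tt: "\<And>x. x \<in> Sp 0 \<Longrightarrow> T (t x) = x"
    and tT: "\<And>u. u \<in> Sp 2 \<Longrightarrow> t (T u) = u"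
    and st: "\<And>x. x \<in> Sp 0 \<Longrightarrow> s (t x) = t (s x)"
    and s_inj: "\<And>x. x \<in> Sp 0 \<Longrightarrow> s x = 0 \<Longrightarrow> x = 0"
    and s4: "\<And>x. x \<in> Sp 0 \<Longrightarrow> s (s (s (s x))) = t (t x)"
    and Sp: "\<And>n. n > 0 \<Longrightarrow> Sp (int n) = (s ^^ n) ` Sp 0"
    and ip_pos: "\<And>n x y. n > 0 \<Longrightarrow> x \<in> Sp 0 \<Longrightarrow> y \<in> Sp 0 \<Longrightarrow>
      ip\<^sub>H X (int n) ((s ^^ n) x) ((s ^^ n) y) = ip\<^sub>H X 0 x y"
    and ip_neg: "\<And>n x y. n > 0 \<Longrightarrow> x \<in> Sp 0 \<Longrightarrow> y \<in> Sp 0 \<Longrightarrow>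
      ip\<^sub>H X (- int n) x y = ip\<^sub>H X 0 ((s ^^ n) x) ((s ^^ n) y)"
    by (rule inverse_and_root) (rule that)
  note sm = H.bsym_mem[OF s] and tm = H.bsym_mem[OF t]
  define x where "x = T u"
  have x: "x \<in> Sp 0" and u: "u = t x"
    using Lz_mem[of u 0] u2 tT by (simp_all add: x_def)
  have ss_inj: "v = w" if "v \<in> Sp 0" "w \<in> Sp 0" "s (s v) = s (s w)" for v w
  proof -
    have "s (s (v - w)) = 0" using that by (simp add: H.bsym_diff[OF s] sm)
    then have "v - w = 0" using s_inj[of "s (v - w)"] s_inj[of "v - w"] that sm by simp
    then show ?thesis by simp
  qed
  have sn: "(s ^^ n) v \<in> Sp 0" if "v \<in> Sp 0" for v n using funpow_closed[of "Sp 0" s] sm that by simp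
  have stn: "(s ^^ n) (t v) = t ((s ^^ n) v)" if "v \<in> Sp 0" for v n
    by (induction n) (use that st sn in auto)
  have iso: "ip\<^sub>H X 0 (t v) (t v) = ip\<^sub>H X 0 (s (s v)) (s (s v))" if v: "v \<in> Sp 0" for v
  proof -
    have "ip\<^sub>H X 0 (t v) (t v) = ip\<^sub>H X 0 v (s (s (s (s v))))"
      using H.bsym_sym[OF t v tm[OF v]] s4[OF v] by simp
    also have "\<dots> = ip\<^sub>H X 0 (s (s v)) (s (s v))" using v sm by (simp add: H.bsym_sym[OF s])
    finally show ?thesis .
  qed
  \<comment> \<open>The order \<open>2 - k\<close> is positive, zero or negative, and its scalar
    product has a different description in each case.\<close>
  consider "k = 1" | "k = 2" | "k > 2" using k by linarith
  then show ?thesis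
  proof cases
    case 1
    obtain y where y: "y \<in> Sp 0" "t x = s (s y)"
      using t2[OF x] Sp[of 2] by (auto simp: numeral_2_eq_2)
    \<comment> \<open>\<open>y\<close> is the image of \<open>x\<close> under the unitary part of \<open>t\<close>.\<close>
    have "s (s (t y)) = t (s (s y))" using y sm by (simp add: st)
    also have "\<dots> = s (s (s (s x)))" using y(2) s4[OF x] by simp
    finally have ty: "t y = s (s x)" using ss_inj[of "t y" "s (s x)"] x y sm tm by simp
    have "ip\<^sub>H X 1 (t x) (t x) = ip\<^sub>H X 0 (s y) (s y)"
      using ip_pos[of 1 "s y" "s y"] y sm by simp
    also have "\<dots> = ip\<^sub>H X 0 y (t x)" using y sm by (simp add: H.bsym_sym[OF s])
    also have "\<dots> = ip\<^sub>H X 0 (s (s x)) x" using H.bsym_sym[OF t y(1) x] by (simp add: ty)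
    also have "\<dots> = ip\<^sub>H X 0 (s x) (s x)" using x sm by (simp add: H.bsym_sym[OF s])
    also have "\<dots> = ip\<^sub>H X (- 1) x x" using ip_neg[of 1 x x] x by simp
    finally show ?thesis using 1 Tt[OF x] by (auto intro!: N_eqI simp: u)
  next
    case 2
    then show ?thesis
      using iso[OF x] ip_neg[of 2 x x] x Tt[OF x] by (auto intro!: N_eqI simp: u numeral_2_eq_2)
  next
    case 3
    define n where "n = k - 2"
    have n: "n > 0" "2 - int k = - int n" "k = Suc (Suc n)" using 3 by (auto simp: n_def)
    have "ip\<^sub>H X (- int n) (t x) (t x) = ip\<^sub>H X 0 (t ((s ^^ n) x)) (t ((s ^^ n) x))"
      using ip_neg[OF n(1) tm[OF x] tm[OF x]] by (simp add: stn[OF x])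
    also have "\<dots> = ip\<^sub>H X (- int k) x x"
      using iso[OF sn[OF x]] ip_neg[OF k x x] by (simp add: n)
    finally show ?thesis using Tt[OF x] n(2) by (auto intro!: N_eqI simp: u)
  qed
qed

lemma T_Sp2:
  assumes "f \<in> Sp 0" obtains u where "u \<in> Sp 2" "T u = f"
  by (rule inverse_and_root) (use assms that in blast)

text \<open>Injectivity of the symmetric maps s and s^2 makes their ranges dense in
  \<open>Sp 0\<close>. For order 1, where u = s g, it suffices to approximate \<open>g\<close> from
  the range of \<open>s\<close>; for negative order, \<open>Sp 0\<close> serves as intermediate
  space.\<close>

lemma dense_Sp2:
  assumes k: "k > 0" and u: "u \<in> Sp (2 - int k)" and e: "e > 0"
  shows "\<exists>v\<in>Sp 2. N (2 - int k) (u - v) < e"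
proof -
  obtain t s where s: "H.bsym 0 s"
    and s_inj: "\<And>x. x \<in> Sp 0 \<Longrightarrow> s x = 0 \<Longrightarrow> x = 0"
    and Sp: "\<And>n. n > 0 \<Longrightarrow> Sp (int n) = (s ^^ n) ` Sp 0"
    and ip_pos: "\<And>n x y. n > 0 \<Longrightarrow> x \<in> Sp 0 \<Longrightarrow> y \<in> Sp 0 \<Longrightarrow>
      ip\<^sub>H X (int n) ((s ^^ n) x) ((s ^^ n) y) = ip\<^sub>H X 0 x y"
    by (rule inverse_and_root) (rule that)
  note sm = H.bsym_mem[OF s]
  have ss: "(s ^^ 2) x = s (s x)" for x by (simp add: numeral_2_eq_2)
  have Sp2: "Sp 2 = (\<lambda>x. s (s x)) ` Sp 0" using Sp[of 2] by (simp add: ss)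
  have dense0: "\<exists>v\<in>Sp 2. N 0 (x - v) < \<delta>" if x: "x \<in> Sp 0" and "\<delta> > 0" for x and \<delta> :: real
    using H.dense_range_bsym[OF H.bsym_funpow[OF s, of 2] _ x \<open>\<delta> > 0\<close>] sm s_inj
    by (simp add: ss Sp2)
  consider "k = 1" | "k = 2" | "k > 2" using k by linarith
  then show ?thesis
  proof cases
    case 1
    obtain g where g: "g \<in> Sp 0" "u = s g" using u 1 Sp[of 1] by auto
    obtain y where y: "y \<in> Sp 0" "N 0 (g - s y) < e"
      using H.dense_range_bsym[OF s s_inj g(1) e] by blast
    have "u - s (s y) = s (g - s y)" using g y sm by (simp add: H.bsym_diff[OF s])
    then have "N 1 (u - s (s y)) = N 0 (g - s y)"
      using ip_pos[of 1 "g - s y" "g - s y"] g y sm by (auto intro!: N_eqI)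
    then show ?thesis using 1 y Sp2 by (intro bexI[of _ "s (s y)"]) auto
  next
    case 2
    then show ?thesis using dense0 u e by simp
  next
    case 3
    let ?n = "2 - int k"
    have neg: "?n < 0" using 3 by simp
    obtain w where w: "w \<in> Sp 0" "N ?n (u - w) < e / 2"
      using hscale neg u e half_gt_zero[OF e] unfolding hilbert_scale_def norm\<^sub>H_def by meson
    obtain C where C: "C \<ge> 0" "\<And>x. x \<in> Sp 0 \<Longrightarrow> N ?n x \<le> C * N 0 x"
      using N_mono[of ?n 0] neg by auto
    \<comment> \<open>\<open>C\<close> bounds the norm of order \<open>2 - k\<close> by that of
      order 0 and may vanish, hence \<open>C + 1\<close>.\<close>
    have "e / (2 * (C + 1)) > 0" using C e by simp
    then obtain v where v: "v \<in> Sp 2" "N 0 (w - v) < e / (2 * (C + 1))" using dense0[OF w(1)] by blast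
    have v0: "v \<in> Sp 0" using Sp_mem[OF v(1)] by simp
    have "N ?n (w - v) \<le> C * N 0 (w - v)" using C(2)[of "w - v"] w v0 by simp
    also have "\<dots> \<le> (C + 1) * N 0 (w - v)" using H.nrm_nonneg[of "w - v" 0] w v0 by (simp add: mult_right_mono)
    also have "\<dots> < e / 2" using v(2) C(1) by (simp add: field_simps)
    finally have "N ?n (w - v) < e / 2" .
    moreover have "w \<in> Sp ?n" "v \<in> Sp ?n" using Sp_mem w(1) v0 neg by auto
    ultimately have "N ?n (u - v) < e" using H.nrm_triangle[of u ?n w v] u w(2) by simp
    then show ?thesis using v by blast
  qed
qed

lemma approx_Sp2:
  assumes "k > 0" "f \<in> Sp (2 - int k)"
  obtains u where "\<And>j::nat. u j \<in> Sp 2" "(\<lambda>j. N (2 - int k) (u j - f)) \<longlonglongrightarrow> 0"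
proof -
  have "\<exists>v\<in>Sp 2. N (2 - int k) (f - v) < 1 / real (Suc j)" for j
    using dense_Sp2[OF assms] by simp
  then obtain u where u: "\<And>j. u j \<in> Sp 2" "\<And>j. N (2 - int k) (f - u j) < 1 / real (Suc j)" by metis
  have un: "u j \<in> Sp (2 - int k)" for j using Sp_mem[OF u(1)] assms(1) by simp
  have "(\<lambda>j. N (2 - int k) (u j - f)) \<longlonglongrightarrow> 0"
  proof (rule tendsto_sandwich[of "\<lambda>n. 0" _ _ "\<lambda>j. 1 / real (Suc j)"])
    show "(\<lambda>j. 1 / real (Suc j)) \<longlonglongrightarrow> 0" by (rule lim_1_over_n[THEN LIMSEQ_Suc])
    show "\<forall>\<^sub>F j in sequentially. N (2 - int k) (u j - f) \<le> 1 / real (Suc j)"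
      using u(2) H.nrm_minus_commute[OF un assms(2)] by (auto intro!: always_eventually less_imp_le)
    show "\<forall>\<^sub>F j in sequentially. 0 \<le> N (2 - int k) (u j - f)"
      using un assms by (auto intro!: always_eventually H.nrm_nonneg)
  qed simp
  then show ?thesis by (rule that[OF u(1)])
qed

text \<open>If elements of \<open>Sp 2\<close> tend to \<open>u\<close>, their images tend to T u =
  0; by the isometry they tend to 0 themselves.\<close>

lemma T_inj_neg:
  assumes k: "k > 0" and u: "u \<in> Sp (2 - int k)" and Tu: "T u = 0"
  shows "u = 0"
proof -
  obtain v where v: "\<And>j::nat. v j \<in> Sp 2" "(\<lambda>j. N (2 - int k) (v j - u)) \<longlonglongrightarrow> 0"
    by (rule approx_Sp2[OF k u]) (rule that)
  have vk: "v j \<in> Sp (2 - int k)" for j using Sp_mem[OF v(1)] k by simp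
  have eq: "- int k + 2 = 2 - int k" by simp
  have "(\<lambda>j. N (- int k) (T (v j) - T u)) \<longlonglongrightarrow> 0"
    using tendsto_Lz[of v "- int k" u z1] vk u v(2) by (simp add: eq)
  then have "(\<lambda>j. N (2 - int k) (v j - 0)) \<longlonglongrightarrow> 0"
    using T_isometric[OF v(1) k] by (simp add: Tu)
  then show ?thesis using H.limit_unique[of v "2 - int k" u 0] vk u v(2) by simp
qed

text \<open>Approximate \<open>f\<close> from \<open>Sp 0\<close>. The preimages in
  \<open>Sp 2\<close> form a Cauchy sequence by the isometry, and continuity of \<open>T\<close>
  identifies the image of their limit.\<close>

lemma T_surj_neg:
  assumes k: "k > 0" and f: "f \<in> Sp (- int k)"
  shows "\<exists>u\<in>Sp (2 - int k). T u = f"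
proof -
  obtain g where g: "\<And>j::nat. g j \<in> Sp 0" "(\<lambda>j. N (- int k) (g j - f)) \<longlonglongrightarrow> 0"
    using approx_Sp0[of "- int k" f] k f by auto
  have "\<exists>v. v \<in> Sp 2 \<and> T v = g j" for j using T_Sp2[OF g(1)] by metis
  then obtain v where v: "\<And>j. v j \<in> Sp 2" "\<And>j. T (v j) = g j" by metis
  have vk: "v j \<in> Sp (2 - int k)" for j using Sp_mem[OF v(1)] k by simp
  have gk: "g j \<in> Sp (- int k)" for j using Sp_mem[OF g(1)] k by simp
  have iso: "N (2 - int k) (v i - v j) = N (- int k) (g i - g j)" for i j
    using T_isometric[OF H.mem_diff[OF v(1) v(1)] k, of i j] by (simp add: Lz_diff v(2))
  have "\<exists>M. \<forall>i\<ge>M. \<forall>j\<ge>M. N (2 - int k) (v i - v j) < e" if "e > 0" for e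
    unfolding iso using H.convergent_imp_cauchy[OF gk f g(2) that] .
  then obtain u where u: "u \<in> Sp (2 - int k)" "(\<lambda>j. N (2 - int k) (v j - u)) \<longlonglongrightarrow> 0"
    using H.complete[of v "2 - int k"] vk by blast
  have eq: "- int k + 2 = 2 - int k" by simp
  have "(\<lambda>j. N (- int k) (T (v j) - T u)) \<longlonglongrightarrow> 0"
    using tendsto_Lz[of v "- int k" u z1] vk u by (simp add: eq)
  then have "(\<lambda>j. N (- int k) (g j - T u)) \<longlonglongrightarrow> 0" by (simp add: v(2))
  moreover have "T u \<in> Sp (- int k)" using Lz_mem[of u "- int k"] u(1) by (simp add: eq)
  ultimately have "T u = f" using H.limit_unique[of g "- int k" "T u" f] gk f g(2) by simp
  then show ?thesis using u(1) by blast
qed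

lemma T_inj: 
  assumes "u \<in> Sp n" "T u = 0" shows "u = 0"
\<comment> \<open>The index is positive and so large that 2 - (3 + |n|) \<le> n.\<close>
proof (rule T_inj_neg[of "nat (3 + \<bar>n\<bar>)"])
  show "u \<in> Sp (2 - int (nat (3 + \<bar>n\<bar>)))" using Sp_mem[OF assms(1)] by simp
qed (use assms in auto)

text \<open>For nonnegative order k write f = s^k g. As \<open>t\<close> commutes with
  \<open>s\<close>, t f = s^k (t g), and \<open>t g\<close>, being in \<open>Sp 2\<close>,
  contributes two further factors \<open>s\<close>.\<close>

lemma T_surj:
  assumes f: "f \<in> Sp n" shows "\<exists>u\<in>Sp (n + 2). T u = f"
proof (cases "n < 0")
  case True
  then show ?thesis using T_surj_neg[of "nat (- n)" f] f by (simp add: add.commute)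
next
  case False
  then obtain k where n: "n = int k" by (metis nat_0_le not_le)
  obtain t s where t: "H.bsym 0 t" and s: "H.bsym 0 s"
    and t2: "\<And>x. x \<in> Sp 0 \<Longrightarrow> t x \<in> Sp 2" and Tt: "\<And>x. x \<in> Sp 0 \<Longrightarrow> T (t x) = x"
    and st: "\<And>x. x \<in> Sp 0 \<Longrightarrow> s (t x) = t (s x)"
    and Sp: "\<And>n. n > 0 \<Longrightarrow> Sp (int n) = (s ^^ n) ` Sp 0"
    by (rule inverse_and_root) (rule that)
  note sm = H.bsym_mem[OF s]
  have sn: "(s ^^ n) v \<in> Sp 0" if "v \<in> Sp 0" for v n using funpow_closed[of "Sp 0" s] sm that by simp
  have stn: "(s ^^ n) (t v) = t ((s ^^ n) v)" if "v \<in> Sp 0" for v n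
    by (induction n) (use that st sn in auto)
  have f0: "f \<in> Sp 0" using Sp_mem[OF f] n by simp
  obtain g where g: "g \<in> Sp 0" "f = (s ^^ k) g"
    using f Sp[of k] n by (cases "k = 0") auto
  obtain y where y: "y \<in> Sp 0" "t g = s (s y)"
    using t2[OF g(1)] Sp[of 2] by (auto simp: numeral_2_eq_2)
  have "t f = (s ^^ k) (s (s y))" using g stn y(2) by metis
  also have "\<dots> = (s ^^ (k + 2)) y" unfolding funpow_add by (simp add: numeral_2_eq_2)
  finally have "t f \<in> Sp (n + 2)" using Sp[of "k + 2"] y(1) n by (simp add: add.commute)
  then show ?thesis using Tt[OF f0] by blast
qed

text \<open>Since \<open>(L - z) u = f\<close> means \<open>T u = f + (z - z\<^sub>1) u\<close>, solutions gain regularity together with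
  the right hand side; conversely, a less regular right hand side \<open>T g\<close> is reduced to the right
  hand side \<open>(z - z\<^sub>1) g\<close> by subtracting \<open>g\<close> from the solution.\<close>

lemma Lz_regularity:
  assumes u: "u \<in> Sp i" and f: "Lz z u \<in> Sp n" shows "u \<in> Sp (n + 2)"
proof -
  \<comment> \<open>Bootstrapping: each round gains two orders up to the cap \<open>n + 2\<close>,
    because the more regular preimage of \<open>T u\<close> must be \<open>u\<close> by
    \<open>T_inj\<close>.\<close>
  have "u \<in> Sp (min (i + 2 * int k) (n + 2))" for k
  proof (induction k)
    case 0
    then show ?case using Sp_mem[OF u] by simp
  next
    case (Suc k)
    let ?j = "min (i + 2 * int k) n"
    have "T u = Lz z u + scl X (z - z1) u" by (simp add: Lz_shift[of z u])
    moreover have "Lz z u \<in> Sp ?j" "u \<in> Sp ?j" using Sp_mem[OF f, of ?j] Sp_mem[OF Suc, of ?j] by auto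
    ultimately obtain v where v: "v \<in> Sp (?j + 2)" "T v = T u" using T_surj[of "T u" ?j] by auto
    have "v - u \<in> Sp (min (?j + 2) i)"
      using Sp_mem[OF v(1), of "min (?j + 2) i"] Sp_mem[OF u, of "min (?j + 2) i"] by simp
    then have "v - u = 0" by (rule T_inj) (simp add: Lz_diff v(2))
    then show ?case using v(1) Sp_mem[of v "?j + 2" "min (i + 2 * int (Suc k)) (n + 2)"] by auto
  qed
  from Sp_mem[OF this[of "nat (n + 2 - i)"], of "n + 2"] show ?thesis by simp
qed

text \<open>The right hand side 0 lies in every space, so by regularity an element of the kernel
  lies in \<open>Sp n\<close>, whatever its original order.\<close>

lemma Lz_inj:
  assumes inj: "\<And>u. u \<in> Sp n \<Longrightarrow> Lz z u = 0 \<Longrightarrow> u = 0" and u: "u \<in> Sp i" "Lz z u = 0"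
  shows "u = 0"
  using Lz_regularity[of u i z "n - 2"] u inj by simp

lemma Lz_surj:
  assumes surj: "\<And>f. f \<in> Sp n \<Longrightarrow> \<exists>u\<in>Sp (n + 2). Lz z u = f" and f: "f \<in> Sp i"
  shows "\<exists>u\<in>Sp (i + 2). Lz z u = f"
proof -
  \<comment> \<open>The order \<open>j\<close> of the solution is left open during the descent;
    \<open>Lz_regularity\<close> restores the right one at the end.\<close>
  have "\<exists>j. \<exists>u\<in>Sp j. Lz z u = f" if "f \<in> Sp (n - 2 * int k)" for k f
    using that
  proof (induction k arbitrary: f)
    case 0
    then show ?case using surj[of f] by auto
  next
    case (Suc k)
    obtain g where g: "g \<in> Sp (n - 2 * int k)" "T g = f" using T_surj[OF Suc.prems] by (auto simp: algebra_simps)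
    obtain j u where u: "u \<in> Sp j" "Lz z u = scl X (z - z1) g" using Suc.IH[of "scl X (z - z1) g"] g by auto
    have "Lz z (g + u) = f" by (simp add: Lz_add u(2)) (simp add: Lz_shift[of z g] g)
    moreover have "g + u \<in> Sp (min j (n - 2 * int k))"
      using Sp_mem[OF g(1), of "min j (n - 2 * int k)"] Sp_mem[OF u(1), of "min j (n - 2 * int k)"] by simp
    ultimately show ?case by blast
  qed
  from this[of f "nat (n - i)"] obtain j u where "u \<in> Sp j" "Lz z u = f"
    using Sp_mem[OF f, of "n - 2 * int (nat (n - i))"] by auto
  then show ?thesis using Lz_regularity[of u j z i] f by auto
qed

end

section \<open>The duality pairing\<close>

context scale
begin

text \<open>Writing f = s^n g and moving s^n to the other argument reduces this to Cauchy-Schwarz in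
  \<open>Sp 0\<close>. The bound is what lets the scalar product of order 0 extend to
  \<open>Sp (- int n)\<close> in its first argument.\<close>

lemma ip0_bound:
  assumes n: "n > 0" and u: "u \<in> Sp 0" and f: "f \<in> Sp (int n)"
  shows "cmod (ip\<^sub>H X 0 u f) \<le> N (- int n) u * N (int n) f"
proof -
  obtain t s where s: "H.bsym 0 s"
    and Sp: "\<And>n. n > 0 \<Longrightarrow> Sp (int n) = (s ^^ n) ` Sp 0"
    and ip_pos: "\<And>n x y. n > 0 \<Longrightarrow> x \<in> Sp 0 \<Longrightarrow> y \<in> Sp 0 \<Longrightarrow>
      ip\<^sub>H X (int n) ((s ^^ n) x) ((s ^^ n) y) = ip\<^sub>H X 0 x y"
    and ip_neg: "\<And>n x y. n > 0 \<Longrightarrow> x \<in> Sp 0 \<Longrightarrow> y \<in> Sp 0 \<Longrightarrow>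
      ip\<^sub>H X (- int n) x y = ip\<^sub>H X 0 ((s ^^ n) x) ((s ^^ n) y)"
    by (rule inverse_and_root) (rule that)
  note sn = H.bsym_funpow[OF s, of n]
  obtain g where g: "g \<in> Sp 0" "f = (s ^^ n) g" using Sp[OF n] f by blast
  have "cmod (ip\<^sub>H X 0 u f) = cmod (ip\<^sub>H X 0 ((s ^^ n) u) g)"
    using H.bsym_sym[OF sn u g(1)] g(2) by simp
  also have "\<dots> \<le> N 0 ((s ^^ n) u) * N 0 g"
    by (rule H.cauchy_schwarz[OF H.bsym_mem[OF sn u] g(1)])
  also have "N 0 ((s ^^ n) u) = N (- int n) u" using ip_neg[OF n u u] by (intro N_eqI) simp
  also have "N 0 g = N (int n) f" using ip_pos[OF n g(1) g(1)] g(2) by (intro N_eqI) simp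
  finally show ?thesis .
qed

text \<open>Justifies the definite description in \<open>pairing\<close>: by
  \<open>ip0_bound\<close> the scalar products along an approximating sequence are Cauchy, with a
  limit independent of the sequence. Linearity of the pairing is later obtained by passing to this
  limit.\<close>

lemma tendsto_pairing:
  assumes n: "n > 0" and \<psi>: "\<psi> \<in> Sp (- int n)" and f: "f \<in> Sp (int n)"
    and u: "\<And>k::nat. u k \<in> Sp 0" "(\<lambda>k. N (- int n) (u k - \<psi>)) \<longlonglongrightarrow> 0"
  shows "(\<lambda>k. ip\<^sub>H X 0 (u k) f) \<longlonglongrightarrow> pairing X (int n) \<psi> f"
proof -
  define P where "P c \<longleftrightarrow> (\<forall>u. (\<forall>k::nat. u k \<in> Sp 0) \<and> (\<lambda>k. N (- int n) (u k - \<psi>)) \<longlonglongrightarrow> 0 \<longrightarrow>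
                 (\<lambda>k. ip\<^sub>H X 0 (u k) f) \<longlonglongrightarrow> c)" for c
  have f0: "f \<in> Sp 0" using Sp_mem[OF f] by simp
  have mem: "v k \<in> Sp (- int n)" if "\<And>k::nat. v k \<in> Sp 0" for v k
    using Sp_mem[OF that[of k], of "- int n"] by simp
  have um: "u k \<in> Sp (- int n)" for k using mem[of u] u(1) by simp
  have diff: "cmod (ip\<^sub>H X 0 v f - ip\<^sub>H X 0 w f) \<le> N (- int n) (v - w) * N (int n) f"
    if "v \<in> Sp 0" "w \<in> Sp 0" for v w
    using ip0_bound[OF n _ f, of "v - w"] that f0 by (simp add: H.ip_diff_left)
  have "Cauchy (\<lambda>k. ip\<^sub>H X 0 (u k) f)"
  proof (rule metric_CauchyI)
    fix e :: real assume "e > 0"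
    \<comment> \<open>The summand 1 covers the case f = 0.\<close>
    then have "e / (N (int n) f + 1) > 0" using H.nrm_nonneg[OF f] by simp
    then obtain M where M: "\<forall>k\<ge>M. \<forall>l\<ge>M. N (- int n) (u k - u l) < e / (N (int n) f + 1)"
      using H.convergent_imp_cauchy[OF um \<psi> u(2)] by blast
    have "dist (ip\<^sub>H X 0 (u k) f) (ip\<^sub>H X 0 (u l) f) < e" if "k \<ge> M" "l \<ge> M" for k l
    proof -
      have nn: "0 \<le> N (- int n) (u k - u l)" "0 \<le> N (int n) f"
        using H.nrm_nonneg um f by auto
      have "N (- int n) (u k - u l) * N (int n) f \<le> N (- int n) (u k - u l) * (N (int n) f + 1)"
        using nn by (simp add: mult_left_mono)
      also have "\<dots> < e" using M that nn by (simp add: pos_less_divide_eq)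
      finally show ?thesis using diff[OF u(1) u(1), of k l] by (simp add: dist_norm)
    qed
    then show "\<exists>M. \<forall>k\<ge>M. \<forall>l\<ge>M. dist (ip\<^sub>H X 0 (u k) f) (ip\<^sub>H X 0 (u l) f) < e" by blast
  qed
  then obtain c where c: "(\<lambda>k. ip\<^sub>H X 0 (u k) f) \<longlonglongrightarrow> c"
    by (auto simp: Cauchy_convergent_iff convergent_def)
  have "P c"
    unfolding P_def
  proof (intro allI impI, elim conjE)
    fix v assume v: "\<forall>k::nat. v k \<in> Sp 0" "(\<lambda>k. N (- int n) (v k - \<psi>)) \<longlonglongrightarrow> 0"
    have vm: "v k \<in> Sp (- int n)" for k using mem[of v] v(1) by simp
    have "(\<lambda>k. (N (- int n) (v k - \<psi>) + N (- int n) (u k - \<psi>)) * N (int n) f) \<longlonglongrightarrow> (0 + 0) * N (int n) f"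
      by (intro tendsto_intros v(2) u(2))
    then have lim: "(\<lambda>k. (N (- int n) (v k - \<psi>) + N (- int n) (u k - \<psi>)) * N (int n) f) \<longlonglongrightarrow> 0" by simp
    have "(\<lambda>k. ip\<^sub>H X 0 (v k) f - ip\<^sub>H X 0 (u k) f) \<longlonglongrightarrow> 0"
    proof (rule Lim_null_comparison[OF always_eventually lim], rule allI)
      fix k
      have "N (- int n) (v k - u k) \<le> N (- int n) (v k - \<psi>) + N (- int n) (u k - \<psi>)"
        using H.nrm_triangle[OF vm \<psi> um, of k k] H.nrm_minus_commute[OF \<psi> um, of k] by simp
      then show "norm (ip\<^sub>H X 0 (v k) f - ip\<^sub>H X 0 (u k) f) \<le>
          (N (- int n) (v k - \<psi>) + N (- int n) (u k - \<psi>)) * N (int n) f"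
        using diff[of "v k" "u k"] v(1) u(1) mult_right_mono H.nrm_nonneg[OF f] by (meson order_trans)
    qed
    from tendsto_add[OF this c] show "(\<lambda>k. ip\<^sub>H X 0 (v k) f) \<longlonglongrightarrow> c" by simp
  qed
  moreover have "d = c" if "P d" for d
    using that u c LIMSEQ_unique unfolding P_def by blast
  ultimately have "(THE c. P c) = c" by (rule the_equality)
  then show ?thesis using c by (simp add: pairing_def P_def norm\<^sub>H_def)
qed

lemma pairing_add:
  assumes n: "n > 0" and \<psi>: "\<psi> \<in> Sp (- int n)" and f: "f \<in> Sp (int n)" and g: "g \<in> Sp (int n)"
  shows "pairing X (int n) \<psi> (f + g) = pairing X (int n) \<psi> f + pairing X (int n) \<psi> g"
proof -
  obtain u where u: "\<And>k::nat. u k \<in> Sp 0" "(\<lambda>k. N (- int n) (u k - \<psi>)) \<longlonglongrightarrow> 0"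
    by (rule approx_Sp0[OF _ \<psi>]) (use n in simp, rule that)
  have 0: "f \<in> Sp 0" "g \<in> Sp 0" using Sp_mem[of _ "int n" 0] f g by auto
  have "(\<lambda>k. ip\<^sub>H X 0 (u k) (f + g)) \<longlonglongrightarrow> pairing X (int n) \<psi> (f + g)"
    by (rule tendsto_pairing[OF n \<psi> _ u]) (use f g in simp)
  moreover have "(\<lambda>k. ip\<^sub>H X 0 (u k) f + ip\<^sub>H X 0 (u k) g) \<longlonglongrightarrow>
      pairing X (int n) \<psi> f + pairing X (int n) \<psi> g"
    by (intro tendsto_add tendsto_pairing[OF n \<psi> _ u] f g)
  ultimately show ?thesis using u(1) 0 LIMSEQ_unique by (simp add: H.ip_add_right)
qed

lemma pairing_scl:
  assumes n: "n > 0" and \<psi>: "\<psi> \<in> Sp (- int n)" and f: "f \<in> Sp (int n)"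
  shows "pairing X (int n) \<psi> (scl X a f) = a * pairing X (int n) \<psi> f"
proof -
  obtain u where u: "\<And>k::nat. u k \<in> Sp 0" "(\<lambda>k. N (- int n) (u k - \<psi>)) \<longlonglongrightarrow> 0"
    by (rule approx_Sp0[OF _ \<psi>]) (use n in simp, rule that)
  have 0: "f \<in> Sp 0" using Sp_mem[of _ "int n" 0] f by auto
  have "(\<lambda>k. ip\<^sub>H X 0 (u k) (scl X a f)) \<longlonglongrightarrow> pairing X (int n) \<psi> (scl X a f)"
    by (rule tendsto_pairing[OF n \<psi> _ u]) (use f in simp)
  moreover have "(\<lambda>k. a * ip\<^sub>H X 0 (u k) f) \<longlonglongrightarrow> a * pairing X (int n) \<psi> f"
    by (intro tendsto_mult_left tendsto_pairing[OF n \<psi> _ u] f)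
  ultimately show ?thesis using u(1) 0 LIMSEQ_unique by (simp add: H.ip_sc_right)
qed

lemma pairing_sum:
  assumes n: "n > 0" and \<psi>: "\<psi> \<in> Sp (- int n)" and "finite I" and f: "\<And>i. i \<in> I \<Longrightarrow> f i \<in> Sp (int n)"
  shows "pairing X (int n) \<psi> (\<Sum>i\<in>I. f i) = (\<Sum>i\<in>I. pairing X (int n) \<psi> (f i))"
  using assms(3) f
proof (induction I rule: finite_induct)
  case empty
  show ?case using pairing_add[OF n \<psi>, of 0 0] by simp
next
  case (insert i I)
  then have "(\<Sum>i\<in>I. f i) \<in> Sp (int n)" by (intro subspace_sum H.subspace_H) auto
  then show ?case using insert pairing_add[OF n \<psi>, of "f i"] by simp
qed


section \<open>Powers of \<open>T\<close> and the resolvent\<close>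

lemma bL_eq: "bL X j = T ^^ j"
proof -
  have "(\<lambda>u. opL X u - scl X z1 u) = T" by (simp add: Lz_def fun_eq_iff)
  then show ?thesis by (simp add: bL_def)
qed

lemma Tn_regularity: "u \<in> Sp i \<Longrightarrow> (T ^^ j) u \<in> Sp n \<Longrightarrow> u \<in> Sp (n + 2 * int j)"
proof (induction j arbitrary: u i)
  case (Suc j)
  have "T u \<in> Sp (i - 2)" using Lz_mem[of u "i - 2"] Suc.prems by simp
  then have "T u \<in> Sp (n + 2 * int j)" using Suc.IH Suc.prems(2) by (simp add: funpow_swap1)
  from Lz_regularity[OF Suc.prems(1) this] show ?case by (simp add: algebra_simps)
qed simp

lemma Tn_inj: "u \<in> Sp i \<Longrightarrow> (T ^^ j) u = 0 \<Longrightarrow> u = 0"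
proof (induction j arbitrary: u i)
  case (Suc j)
  have "T u \<in> Sp (i - 2)" using Lz_mem[of u "i - 2"] Suc.prems by simp
  then have "T u = 0" using Suc.IH Suc.prems(2) by (simp add: funpow_swap1)
  then show ?case using T_inj[OF Suc.prems(1)] by simp
qed simp

lemma Tn_diff: "(T ^^ j) (u - v) = (T ^^ j) u - (T ^^ j) v"
  by (induction j) (simp_all add: Lz_diff)

lemma Tn_surj: "f \<in> Sp n \<Longrightarrow> \<exists>u\<in>Sp (n + 2 * int j). (T ^^ j) u = f"
proof (induction j)
  case (Suc j)
  then obtain u where u: "u \<in> Sp (n + 2 * int j)" "(T ^^ j) u = f" by blast
  obtain v where "v \<in> Sp (n + 2 * int j + 2)" "T v = u" using T_surj[OF u(1)] by blast
  then show ?case using u(2) by (intro bexI[of _ v]) (simp_all add: funpow_swap1 algebra_simps)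
qed simp

lemma mem_min: "u \<in> Sp i \<Longrightarrow> v \<in> Sp j \<Longrightarrow> u - v \<in> Sp (min i j)"
  using Sp_mem[of u i "min i j"] Sp_mem[of v j "min i j"] by simp

text \<open>Two candidates of different orders are compared in the space of the smaller order, where
  powers of \<open>T\<close> are still injective.\<close>

lemma bL_inv_eqI:
  assumes "u \<in> Sp i" "(T ^^ j) u = f" shows "bL_inv X j f = u"
  unfolding bL_inv_def bL_eq
proof (rule the_equality)
  fix v assume v: "v \<in> (\<Union>n. Sp n) \<and> (T ^^ j) v = f"
  then obtain i' where "v \<in> Sp i'" by blast
  from mem_min[OF this assms(1)] have "v - u = 0" by (rule Tn_inj[where j = j]) (use v assms in \<open>simp add: Tn_diff\<close>)
  then show "v = u" by simp
qed (use assms in auto)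

lemma bL_inv_props:
  assumes "f \<in> Sp n" shows "bL_inv X j f \<in> Sp (n + 2 * int j)" "(T ^^ j) (bL_inv X j f) = f"
  using Tn_surj[OF assms, of j] bL_inv_eqI by auto

end

text \<open>Bijectivity is recorded algebraically and at one order, as \<open>Lres\<close> enters
  the formulas as a linear solution operator. Kernel elements are taken from \<open>Sp m\<close>;
  they automatically lie in \<open>Sp (m + 2)\<close>.\<close>

locale scale_res = scale +
  fixes z and m :: int
  assumes res_inj: "\<And>u. u \<in> space\<^sub>H X m \<Longrightarrow> Lz z u = 0 \<Longrightarrow> u = 0"
    and res_surj: "\<And>f. f \<in> space\<^sub>H X m \<Longrightarrow> \<exists>u\<in>space\<^sub>H X (m + 2). Lz z u = f"
begin

lemma Lres_eqI:
  assumes u: "u \<in> Sp i" "Lz z u = f" shows "Lres X z f = u"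
  unfolding Lres_def
proof (rule the_equality)
  fix v assume v: "v \<in> (\<Union>n. Sp n) \<and> opL X v - scl X z v = f"
  then obtain i' where "v \<in> Sp i'" by blast
  have "v - u = 0"
  proof (rule Lz_inj[OF res_inj])
    show "v - u \<in> Sp (min i' i)" using mem_min[OF \<open>v \<in> Sp i'\<close> assms(1)] .
    show "Lz z (v - u) = 0" using v u(2) by (simp add: Lz_diff) (simp add: Lz_def)
  qed
  then show "v = u" by simp
qed (use u in \<open>auto simp: Lz_def\<close>)

lemma Lres_props:
  assumes "f \<in> Sp i"
  shows "Lres X z f \<in> Sp (i + 2)" "Lz z (Lres X z f) = f"
  using Lz_surj[OF res_surj assms] Lres_eqI by auto

lemma Lres_add:
  assumes "f \<in> Sp i" "g \<in> Sp i" shows "Lres X z (f + g) = Lres X z f + Lres X z g"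
  by (rule Lres_eqI[of _ "i + 2"]) (use Lres_props assms in \<open>simp_all add: Lz_add\<close>)

lemma Lres_scl:
  assumes "f \<in> Sp i" shows "Lres X z (scl X a f) = scl X a (Lres X z f)"
  by (rule Lres_eqI[of _ "i + 2"]) (use Lres_props assms in \<open>simp_all add: Lz_scl\<close>)

lemma Lres_sum:
  assumes "finite I" "\<And>j. j \<in> I \<Longrightarrow> f j \<in> Sp i"
  shows "Lres X z (\<Sum>j\<in>I. f j) = (\<Sum>j\<in>I. Lres X z (f j))"
  using assms
proof (induction I rule: finite_induct)
  case empty
  show ?case by (simp add: Lres_eqI[of 0 0])
next
  case (insert j I)
  then have "(\<Sum>j\<in>I. f j) \<in> Sp i" by (intro subspace_sum H.subspace_H) auto
  then show ?case using insert Lres_add[of "f j" i] by simp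
qed

end

section \<open>The model space\<close>

locale peak =
  fixes X :: "('v::ab_group_add, 'i::finite) peak_data"
  assumes peak: "peak_model X"
begin

sublocale scale X
  using peak by unfold_locales (simp add: peak_model_def)

abbreviation m :: nat where "m \<equiv> ord\<^sub>m X"
abbreviation h :: "'i \<Rightarrow> nat \<Rightarrow> 'v" where "h \<equiv> hvec X"
abbreviation hc :: "nat \<Rightarrow> 'i cvec \<Rightarrow> 'v" where "hc \<equiv> hcomb X"
abbreviation I :: "('i \<times> nat) set" where "I \<equiv> idx X"

section \<open>The vectors h_(sigma j), their regularity and their independence\<close>

lemma m_pos: "1 \<le> m"
  using peak by (simp add: peak_model_def)

lemma func_mem: "func X \<sigma> \<in> Sp (- int m - 2)"
  using peak by (simp add: peak_model_def)

lemma finite_I [simp]: "finite I"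
  by (simp add: idx_def)

lemma h_mem: "h \<sigma> j \<in> Sp (2 * int j - int m - 2)"
  using bL_inv_props(1)[OF func_mem, of j] by (simp add: hvec_def algebra_simps)

lemma T_h: "T (h \<sigma> (Suc j)) = h \<sigma> j"
proof -
  have "T (h \<sigma> (Suc j)) \<in> Sp (2 * int j - int m - 2)"
    using Lz_mem[of "h \<sigma> (Suc j)" "2 * int j - int m - 2"] h_mem[of \<sigma> "Suc j"] by (simp add: algebra_simps)
  moreover have "(T ^^ j) (T (h \<sigma> (Suc j))) = func X \<sigma>"
    using bL_inv_props(2)[OF func_mem, of "Suc j"] by (simp add: hvec_def funpow_swap1)
  ultimately show ?thesis unfolding hvec_def by (rule bL_inv_eqI[symmetric])
qed

lemma h_0: "h \<sigma> 0 = func X \<sigma>"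
  unfolding hvec_def by (rule bL_inv_eqI[OF func_mem]) simp

lemma hc_mem: "hc j c \<in> Sp (2 * int j - int m - 2)"
  unfolding hcomb_def by (intro subspace_sum H.subspace_H H.mem_sc h_mem)

lemma hc_diff: "hc j (c - d) = hc j c - hc j d"
  and hc_0 [simp]: "hc j 0 = 0"
  by (simp_all add: hcomb_def scale_left_diff_distrib sum_subtractf)

lemma Lz_sum: "Lz z (\<Sum>i\<in>A. f i) = (\<Sum>i\<in>A. Lz z (f i))"
  by (induction A rule: infinite_finite_induct) (simp_all add: Lz_add)

lemma T_hc: "T (hc (Suc j) c) = hc j c"
  by (simp add: hcomb_def Lz_sum Lz_scl T_h)

lemma Tn_hc: "(T ^^ n) (hc (n + j) c) = hc j c"
  by (induction n) (simp_all add: funpow_swap1 T_hc)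

text \<open>Applying T^j turns the combination of the \<open>h \<sigma> j\<close> into the same
  combination of the functionals, which are independent.\<close>

lemma hc_eq_0:
  assumes "hc j c = 0" shows "c = 0"
proof -
  have inj: "inj (func X)" and indep: "independent (range (func X))"
    using peak by (auto simp: peak_model_def)
  have "hc 0 c = 0" using Tn_hc[of j 0 c] assms Tn_diff[of j 0 0] by simp
  \<comment> \<open>Independence concerns the set of functionals, so the sum over indices is
    rewritten over that set, using injectivity of \<open>func X\<close>.\<close>
  then have "(\<Sum>v\<in>range (func X). scl X (c $ inv (func X) v) v) = 0"
    using inj by (simp add: hcomb_def h_0 sum.reindex)
  then have "c $ inv (func X) (func X \<sigma>) = 0" for \<sigma>
    using independentD[OF indep _ subset_refl, of "\<lambda>v. c $ inv (func X) v" "func X \<sigma>"] by simp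
  then show ?thesis using inj by (simp add: vec_eq_iff)
qed

text \<open>The inverse of \<open>coord\<close>, up to coefficients outside \<open>I\<close>: they
  are ignored here, while \<open>coord\<close> returns 0 there.\<close>

definition comb :: "('i \<times> nat \<Rightarrow> complex) \<Rightarrow> 'v" where
  "comb a = (\<Sum>p\<in>I. scl X (a p) (h (fst p) (snd p)))"

lemma comb_add: "comb (\<lambda>p. a p + b p) = comb a + comb b"
  and comb_diff: "comb (\<lambda>p. a p - b p) = comb a - comb b"
  and comb_scl: "comb (\<lambda>p. x * a p) = scl X x (comb a)"
  and comb_0 [simp]: "comb (\<lambda>p. 0) = 0"
  by (simp_all add: comb_def scale_left_distrib scale_left_diff_distrib sum.distrib sum_subtractf
      scale_sum_right)

lemma comb_cong: "(\<And>p. p \<in> I \<Longrightarrow> a p = b p) \<Longrightarrow> comb a = comb b"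
  by (simp add: comb_def)

lemma comb_eq_hc: "comb a = (\<Sum>j = 1..m. hc j (\<chi> \<sigma>. a (\<sigma>, j)))"
  unfolding comb_def hcomb_def idx_def
  by (subst sum.swap) (simp add: sum.cartesian_product split_def)

lemma K_A_iff: "k \<in> K\<^sub>A X \<longleftrightarrow> (\<exists>a. k = comb a)"
proof
  let ?S = "{h \<sigma> j | \<sigma> j. (\<sigma>, j) \<in> I}"
  assume "k \<in> K\<^sub>A X"
  then have "k \<in> span ?S" by (simp add: K\<^sub>A_def)
  then show "\<exists>a. k = comb a"
  proof (induction rule: span_induct_alt)
    case base
    show ?case by (intro exI[of _ "\<lambda>p. 0"]) simp
  next
    case (step x v k)
    then obtain \<sigma> j a where *: "v = h \<sigma> j" "(\<sigma>, j) \<in> I" "k = comb a" by blast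
    have "comb (\<lambda>p. if p = (\<sigma>, j) then x else 0) = (\<Sum>p\<in>I. if p = (\<sigma>, j) then scl X x v else 0)"
      unfolding comb_def by (intro sum.cong) (auto simp: *)
    also have "\<dots> = scl X x v" using * by simp
    finally have "scl X x v + k = comb (\<lambda>p. (if p = (\<sigma>, j) then x else 0) + a p)"
      unfolding comb_add using * by simp
    then show ?case by blast
  qed
next
  assume "\<exists>a. k = comb a"
  then obtain a where k: "k = comb a" by blast
  show "k \<in> K\<^sub>A X"
    unfolding K\<^sub>A_def k comb_def by (intro span_sum span_scale span_base CollectI) (metis prod.collapse)
qed

lemma subspace_K_A: "subspace (K\<^sub>A X)"
  by (simp add: K\<^sub>A_def)

lemma comb_mem [simp]: "comb a \<in> K\<^sub>A X"
  using K_A_iff by blast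

lemma comb_eta: "comb (eta X c) = hc m c"
proof -
  have "comb (eta X c) = (\<Sum>j = 1..m. if j = m then hc m c else 0)"
    unfolding comb_eq_hc by (intro sum.cong) (auto simp: eta_def hcomb_def)
  then show ?thesis using m_pos by simp
qed

lemma hc_m_mem [simp]: "hc m c \<in> K\<^sub>A X"
  using comb_mem[of "eta X c"] by (simp add: comb_eta)

lemma hc_m_regular:
  assumes "hc m c \<in> Sp (int m - 1)" shows "c = 0"
proof -
  have "K\<^sub>A X \<inter> Sp (int m - 1) = {0}" using peak by (simp add: peak_model_def)
  then have "hc m c = 0" using assms hc_m_mem by blast
  then show ?thesis by (rule hc_eq_0)
qed

text \<open>Applying a power of \<open>T\<close> moves a combination of the \<open>h\<^sub>\<sigma>\<^sub>j\<close> that is too regular into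
  \<open>Sp (m - 1)\<close>.\<close>

lemma hc_regular:
  assumes "j \<le> m" "hc j c \<in> Sp (2 * int j - int m - 1)" shows "c = 0"
proof (rule hc_m_regular)
  have "(T ^^ (m - j)) (hc m c) = hc j c" using Tn_hc[of "m - j" j c] assms(1) by simp
  then have "hc m c \<in> Sp (2 * int j - int m - 1 + 2 * int (m - j))"
    using Tn_regularity[OF hc_mem[of m c], of "m - j" "2 * int j - int m - 1"] assms(2) by simp
  then show "hc m c \<in> Sp (int m - 1)" using assms(1) by (simp add: of_nat_diff algebra_simps)
qed

text \<open>Grouping by \<open>j\<close> sorts a combination by regularity. In the strong induction
  the layers below \<open>j\<close> vanish, those above lie in \<open>Sp (2 * j - m)\<close>, and so
  does \<open>comb a\<close> because j < m. Hence layer \<open>j\<close> is regular enough for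
  \<open>hc_regular\<close> to remove it.\<close>

lemma comb_regular:
  assumes a: "comb a \<in> Sp (int m - 2)" and j: "1 \<le> j" "j < m"
  shows "a (\<sigma>, j) = 0"
  using j
proof (induction j arbitrary: \<sigma> rule: less_induct)
  case (less j)
  let ?c = "\<lambda>j. \<chi> \<sigma>. a (\<sigma>, j)" and ?n = "2 * int j - int m"
  have "comb a = (\<Sum>j' = 1..m. hc j' (?c j'))" by (rule comb_eq_hc)
  also have "\<dots> = (\<Sum>j' = j..m. hc j' (?c j'))"
  proof (rule sum.mono_neutral_right)
    show "\<forall>i\<in>{1..m} - {j..m}. hc i (?c i) = 0"
    proof
      fix i assume i: "i \<in> {1..m} - {j..m}"
      then have "?c i = 0" using less.IH less.prems by (auto simp: vec_eq_iff)
      then show "hc i (?c i) = 0" by simp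
    qed
  qed (use less.prems in auto)
  also have "\<dots> = hc j (?c j) + (\<Sum>j' = Suc j..m. hc j' (?c j'))"
    using less.prems by (intro sum.atLeast_Suc_atMost) simp
  finally have eq: "hc j (?c j) = comb a - (\<Sum>j' = Suc j..m. hc j' (?c j'))" by simp
  have "(\<Sum>j' = Suc j..m. hc j' (?c j')) \<in> Sp ?n"
  proof (intro subspace_sum H.subspace_H)
    fix i assume "i \<in> {Suc j..m}"
    then show "hc i (?c i) \<in> Sp ?n" by (intro Sp_mem[OF hc_mem[of i]]) simp
  qed
  moreover have "comb a \<in> Sp ?n" using less.prems by (intro Sp_mem[OF a]) simp
  ultimately have "hc j (?c j) \<in> Sp ?n" unfolding eq by simp
  then have "hc j (?c j) \<in> Sp (2 * int j - int m - 1)" by (rule Sp_mem) simp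
  with less.prems have "?c j = 0" by (intro hc_regular) auto
  then show ?case by (simp add: vec_eq_iff)
qed

lemma comb_min:
  assumes "comb a \<in> Sp (int m - 2)" shows "comb a = hc m (\<chi> \<sigma>. a (\<sigma>, m))"
proof -
  have "comb a = comb (eta X (\<chi> \<sigma>. a (\<sigma>, m)))"
    using comb_regular[OF assms] by (intro comb_cong) (fastforce simp: eta_def idx_def)
  then show ?thesis by (simp add: comb_eta)
qed

text \<open>As 0 lies in \<open>Sp (m - 2)\<close>, \<open>comb_regular\<close> removes all layers
  but the top one, and \<open>hc_eq_0\<close> removes that. This is what makes coordinates in
  \<open>K\<^sub>A X\<close> unique.\<close>

lemma comb_eq_0:
  assumes "comb a = 0" "p \<in> I" shows "a p = 0"
proof -
  obtain \<sigma> j where p: "p = (\<sigma>, j)" "1 \<le> j" "j \<le> m" using assms(2) by (auto simp: idx_def)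
  have "hc m (\<chi> \<sigma>. a (\<sigma>, m)) = 0" using comb_min[of a] assms(1) by simp
  then have "(\<chi> \<sigma>. a (\<sigma>, m)) = 0" by (rule hc_eq_0)
  then show ?thesis using comb_regular[of a j \<sigma>] assms(1) p by (cases "j = m") (auto simp: vec_eq_iff)
qed

lemma coord_comb: "coord X (comb a) p = (if p \<in> I then a p else 0)"
proof -
  let ?b = "\<lambda>p. if p \<in> I then a p else 0"
  have "coord X (comb a) = ?b"
    unfolding coord_def comb_def[symmetric]
  proof (rule the_equality)
    show "(\<forall>p. p \<notin> I \<longrightarrow> ?b p = 0) \<and> comb a = comb ?b"
      by (auto intro: comb_cong)
    fix b assume b: "(\<forall>p. p \<notin> I \<longrightarrow> b p = 0) \<and> comb a = comb b"
    then have "comb (\<lambda>p. a p - b p) = 0" by (simp add: comb_diff)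
    then have "a p - b p = 0" if "p \<in> I" for p using comb_eq_0[of "\<lambda>p. a p - b p"] that by simp
    then show "b = ?b" using b by (auto simp: fun_eq_iff)
  qed
  then show ?thesis by simp
qed

lemma coord_hc: "p \<in> I \<Longrightarrow> coord X (hc m c) p = eta X c p"
  using coord_comb[of "eta X c" p] by (simp add: comb_eta)

lemma K_A_min_iff: "k \<in> K\<^sub>A_min X \<longleftrightarrow> (\<exists>c. k = hc m c)"
proof
  assume k: "k \<in> K\<^sub>A_min X"
  then obtain a where "k = comb a" by (auto simp: K\<^sub>A_min_def K_A_iff)
  with k show "\<exists>c. k = hc m c" using comb_min[of a] by (auto simp: K\<^sub>A_min_def)
qed (use hc_mem[of m] in \<open>auto simp: K\<^sub>A_min_def\<close>)

lemma K_A_regular: "k \<in> K\<^sub>A X \<Longrightarrow> k \<in> Sp (int m) \<Longrightarrow> k = 0"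
  using Sp_mem[of k "int m" "int m - 1"] peak by (auto simp: peak_model_def)

lemma direct_sum:
  assumes "f + k = g + l" "f \<in> Sp (int m)" "g \<in> Sp (int m)" "k \<in> K\<^sub>A X" "l \<in> K\<^sub>A X"
  shows "f = g \<and> k = l"
proof -
  have eq: "k - l = g - f" using assms(1) by (simp add: algebra_simps)
  have "k - l \<in> K\<^sub>A X" using assms(4,5) by (rule subspace_diff[OF subspace_K_A])
  moreover have "k - l \<in> Sp (int m)" unfolding eq using assms(2,3) by simp
  ultimately have "k - l = 0" by (rule K_A_regular)
  then have "k = l" by simp
  with assms(1) show ?thesis by (simp only: add_right_cancel simp_thms)
qed

section \<open>Projection, indefinite inner product and orthogonal complement\<close>

lemma projH_eq: "f \<in> Sp (int m) \<Longrightarrow> k \<in> K\<^sub>A X \<Longrightarrow> projH X (f + k) = f"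
  unfolding projH_def
proof (rule the_equality)
  fix g assume fk: "f \<in> Sp (int m)" "k \<in> K\<^sub>A X" and g: "g \<in> Sp (int m) \<and> f + k - g \<in> K\<^sub>A X"
  have "g + (f + k - g) = f + k" by simp
  from direct_sum[OF this] show "g = f" using fk g by blast
qed simp

lemma ip_A_eq:
  assumes "f \<in> Sp (int m)" "g \<in> Sp (int m)"
  shows "ip\<^sub>A X (f + comb a) (g + comb b) =
    ip\<^sub>H X (int m) f g + (\<Sum>p\<in>I. cnj (a p) * (\<Sum>q\<in>I. gram X p q * b q))"
  using assms by (simp add: ip\<^sub>A_def projH_eq coord_comb)

lemma sum_I_eta: "(\<Sum>p\<in>I. w p * eta X c p) = (\<Sum>\<sigma>\<in>UNIV. w (\<sigma>, m) * c $ \<sigma>)"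
proof -
  have "(\<Sum>p\<in>I. w p * eta X c p) = (\<Sum>p\<in>UNIV \<times> {m}. w p * eta X c p)"
    by (rule sum.mono_neutral_right) (use m_pos in \<open>auto simp: idx_def eta_def\<close>)
  also have "\<dots> = (\<Sum>\<sigma>\<in>UNIV. \<Sum>j\<in>{m}. w (\<sigma>, j) * eta X c (\<sigma>, j))"
    unfolding sum.cartesian_product by (simp add: split_def)
  finally show ?thesis by (simp add: eta_def)
qed

text \<open>The entries are the indefinite products of the vectors \<open>h \<sigma> m\<close> with
  \<open>comb b\<close>, so \<open>gram_row b = 0\<close> expresses orthogonality to
  \<open>K\<^sub>A_min X\<close>.\<close>

definition gram_row :: "('i \<times> nat \<Rightarrow> complex) \<Rightarrow> 'i cvec" where
  "gram_row b = (\<chi> \<sigma>. \<Sum>q\<in>I. gram X (\<sigma>, m) q * b q)"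

lemma gram_row_diff: "gram_row (\<lambda>p. a p - b p) = gram_row a - gram_row b"
  and gram_row_add: "gram_row (\<lambda>p. a p + b p) = gram_row a + gram_row b"
  and gram_row_scl: "gram_row (\<lambda>p. x * a p) = x *s gram_row a"
  by (simp_all add: gram_row_def vec_eq_iff algebra_simps sum.distrib sum_subtractf sum_distrib_left)

lemma gram_row_cong: "(\<And>p. p \<in> I \<Longrightarrow> a p = b p) \<Longrightarrow> gram_row a = gram_row b"
  by (simp add: gram_row_def)

lemma gram_row_eta: "gram_row (eta X c) = gram_min X *v c"
  by (simp add: gram_row_def gram_min_def vec_eq_iff matrix_vector_mult_def sum_I_eta)

lemma gram_row_Md_eta: "gram_row (Md_apply X (eta X c)) = Delta X *v c"
proof -
  have "gram_row (Md_apply X (eta X c)) $ \<sigma> = (Delta X *v c) $ \<sigma>" for \<sigma>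
  proof -
    have "gram_row (Md_apply X (eta X c)) $ \<sigma> =
        (\<Sum>q\<in>I. \<Sum>\<sigma>'\<in>UNIV. gram X (\<sigma>, m) q * Mdmat X q (\<sigma>', m) * c $ \<sigma>')"
      by (simp add: gram_row_def Md_apply_def sum_I_eta sum_distrib_left mult.assoc)
    also have "\<dots> = (\<Sum>\<sigma>'\<in>UNIV. \<Sum>q\<in>I. gram X (\<sigma>, m) q * Mdmat X q (\<sigma>', m) * c $ \<sigma>')"
      by (rule sum.swap)
    finally show ?thesis by (simp add: Delta_def matrix_vector_mult_def sum_distrib_right)
  qed
  then show ?thesis by (simp add: vec_eq_iff)
qed

lemma ip_A_min:
  assumes "g \<in> Sp (int m)" "f \<in> Sp (int m)"
  shows "ip\<^sub>A X (g + hc m c) (f + comb b) =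
    ip\<^sub>H X (int m) g f + (\<Sum>\<sigma>\<in>UNIV. cnj (c $ \<sigma>) * gram_row b $ \<sigma>)"
proof -
  have "ip\<^sub>A X (g + hc m c) (f + comb b) = ip\<^sub>H X (int m) g f +
      (\<Sum>p\<in>I. (\<Sum>q\<in>I. gram X p q * b q) * eta X (\<chi> \<sigma>. cnj (c $ \<sigma>)) p)"
    unfolding comb_eta[symmetric] ip_A_eq[OF assms]
    by (intro arg_cong2[of _ _ _ _ "(+)"] sum.cong) (simp_all add: eta_def mult.commute)
  then show ?thesis
    using sum_I_eta[of "\<lambda>p. \<Sum>q\<in>I. gram X p q * b q" "\<chi> \<sigma>. cnj (c $ \<sigma>)"]
    by (simp add: gram_row_def mult.commute)
qed

text \<open>\<open>Sp m\<close> lies in \<open>H\<^sub>A_min X\<close> and is orthogonal to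
  \<open>K\<^sub>A X\<close>, so testing against the component in \<open>Sp m\<close> itself makes
  that component vanish; testing against single \<open>h \<sigma> m\<close> then isolates the
  entries of \<open>gram_row\<close>.\<close>

lemma H_A_perp_iff: "x \<in> H\<^sub>A_perp X \<longleftrightarrow> (\<exists>b. x = comb b \<and> gram_row b = 0)"
proof
  assume x: "x \<in> H\<^sub>A_perp X"
  then obtain f b where f: "f \<in> Sp (int m)" "x = f + comb b"
    by (auto simp: H\<^sub>A_perp_def H\<^sub>A_def K_A_iff)
  have orth: "ip\<^sub>H X (int m) g f + (\<Sum>\<sigma>\<in>UNIV. cnj (c $ \<sigma>) * gram_row b $ \<sigma>) = 0"
    if "g \<in> Sp (int m)" for g c
  proof -
    have "g + hc m c \<in> H\<^sub>A_min X" using that by (auto simp: H\<^sub>A_min_def K_A_min_iff)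
    then show ?thesis using x ip_A_min[OF that f(1), of c b] f(2) by (simp add: H\<^sub>A_perp_def)
  qed
  have "f = 0" using orth[OF f(1), of 0] H.ip_pos[OF f(1)] by fastforce
  moreover have "gram_row b $ \<sigma> = 0" for \<sigma>
  proof -
    have "(\<Sum>\<sigma>'\<in>UNIV. cnj (axis \<sigma> 1 $ \<sigma>') * gram_row b $ \<sigma>') = gram_row b $ \<sigma>"
      by (simp add: axis_def if_distrib[of cnj] if_distrib[of "\<lambda>x. x * _"] cong: if_cong)
    then show ?thesis using orth[of 0 "axis \<sigma> 1"] f(1) by simp
  qed
  ultimately show "\<exists>b. x = comb b \<and> gram_row b = 0"
    using f(2) by (intro exI[of _ b]) (simp add: vec_eq_iff)
next
  assume "\<exists>b. x = comb b \<and> gram_row b = 0"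
  then obtain b where b: "x = comb b" "gram_row b = 0" by blast
  have "x \<in> H\<^sub>A X" unfolding H\<^sub>A_def using b(1) by (intro CollectI exI[of _ 0] exI[of _ "comb b"]) simp
  moreover have "ip\<^sub>A X y x = 0" if y: "y \<in> H\<^sub>A_min X" for y
  proof -
    obtain g c where g: "g \<in> Sp (int m)" "y = g + hc m c"
      using y by (auto simp: H\<^sub>A_min_def K_A_min_iff)
    show ?thesis using ip_A_min[OF g(1) H.mem_0, of c b] b g by simp
  qed
  ultimately show "x \<in> H\<^sub>A_perp X" by (simp add: H\<^sub>A_perp_def)
qed


section \<open>Decomposition of the elements of the maximal relation\<close>

lemma hc_Suc_m_mem [simp]: "hc (Suc m) c \<in> Sp (int m)"
  using hc_mem[of "Suc m" c] by simp

lemma opL_in_Sp_m: "f \<in> Sp (int m + 2) \<Longrightarrow> opL X f \<in> Sp (int m)"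
  by (rule opL_mem)

lemma Sp_m2_in_Sp_m: "f \<in> Sp (int m + 2) \<Longrightarrow> f \<in> Sp (int m)"
  by (erule Sp_mem) simp

text \<open>A first component in \<open>H\<^sub>A_min X\<close> has its summand from
  \<open>K\<^sub>A X\<close> equal to some h_m(a): h_(m+1)(c) lies in \<open>Sp m\<close>, and the
  sum of \<open>Sp m\<close> and \<open>K\<^sub>A X\<close> is direct.\<close>

lemma B_max_iff: "x \<in> B_max X \<longleftrightarrow> (\<exists>f c a. B_decomp X x f c a)"
proof
  assume "x \<in> B_max X"
  then obtain u u' k0 where x: "x = (u, u' + k0)" and k0: "k0 \<in> H\<^sub>A_perp X" and A: "(u, u') \<in> A_max X"
    and u: "u \<in> H\<^sub>A_min X"
    by (auto simp: B_max_def componentwise_sum_def)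
  obtain f c k k' where f: "f \<in> Sp (int m + 2)" and k: "k \<in> K\<^sub>A X" and k': "k' \<in> K\<^sub>A X"
    and co: "\<forall>p\<in>I. coord X k' p = Md_apply X (coord X k) p + eta X c p"
    and ueq: "u = f + hc (m + 1) c + k" and u'eq: "u' = opL X f + scl X z1 (hc (m + 1) c) + k'"
    using A by (auto simp: A_max_def)
  obtain g a where g: "g \<in> Sp (int m)" "u = g + hc m a"
    using u by (auto simp: H\<^sub>A_min_def K_A_min_iff)
  have "k = hc m a"
    using direct_sum[of "f + hc (m + 1) c" k g "hc m a"] g f k ueq Sp_m2_in_Sp_m[OF f] by simp
  moreover have "Md_apply X (coord X (hc m a)) p = Md_apply X (eta X a) p" for p
    unfolding Md_apply_def by (intro sum.cong) (simp_all add: coord_hc)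
  ultimately have "B_decomp X x f c a"
    unfolding B_decomp_def using x f co ueq u'eq
    by (intro conjI bexI[OF bexI[OF _ k0] k']) simp_all
  then show "\<exists>f c a. B_decomp X x f c a" by blast
next
  assume "\<exists>f c a. B_decomp X x f c a"
  then obtain f c a k' k where f: "f \<in> Sp (int m + 2)" and k': "k' \<in> K\<^sub>A X" and k: "k \<in> H\<^sub>A_perp X"
    and co: "\<forall>p\<in>I. coord X k' p = Md_apply X (eta X a) p + eta X c p"
    and x: "fst x = f + hc (m + 1) c + hc m a"
      "snd x = opL X f + scl X z1 (hc (m + 1) c) + k' + k"
    unfolding B_decomp_def by blast
  let ?u = "fst x" and ?u' = "opL X f + scl X z1 (hc (m + 1) c) + k'"
  have "Md_apply X (coord X (hc m a)) p = Md_apply X (eta X a) p" for p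
    unfolding Md_apply_def by (intro sum.cong) (simp_all add: coord_hc)
  then have "(?u, ?u') \<in> A_max X"
    unfolding A_max_def x(1) using f k' co
    by (intro CollectI exI[of _ f] exI[of _ c] exI[of _ "hc m a"] exI[of _ k']) simp
  moreover have "?u \<in> H\<^sub>A_min X"
    unfolding H\<^sub>A_min_def x(1) using Sp_m2_in_Sp_m[OF f] K_A_min_iff
    by (intro CollectI exI[of _ "f + hc (m + 1) c"] exI[of _ "hc m a"]) auto
  moreover have "?u' \<in> H\<^sub>A X"
    unfolding H\<^sub>A_def using opL_in_Sp_m[OF f] k'
    by (intro CollectI exI[of _ "opL X f + scl X z1 (hc (m + 1) c)"] exI[of _ k']) simp
  moreover have "x = (?u + 0, ?u' + k)" using x by (simp add: prod_eq_iff)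
  ultimately show "x \<in> B_max X"
    unfolding B_max_def componentwise_sum_def using k by blast
qed

text \<open>Directness separates the h_m part. The vector h_(m+1)(c - d) then lies in
  \<open>Sp (m + 2)\<close>, so its image h_m(c - d) under \<open>T\<close> lies in
  \<open>Sp m\<close> and is too regular unless c = d. The boundary maps are well defined for this
  reason.\<close>

lemma decomp_unique:
  assumes "f + hc (Suc m) c + hc m a = g + hc (Suc m) d + hc m b"
    and f: "f \<in> Sp (int m + 2)" and g: "g \<in> Sp (int m + 2)"
  shows "f = g \<and> c = d \<and> a = b"
proof -
  have *: "f + hc (Suc m) c = g + hc (Suc m) d \<and> hc m a = hc m b"
    using assms Sp_m2_in_Sp_m by (intro direct_sum) simp_all
  then have "hc m (a - b) = 0" by (simp add: hc_diff)
  then have ab: "a = b" using hc_eq_0 by fastforce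
  have "hc (Suc m) (c - d) = g - f" using * by (simp add: hc_diff algebra_simps)
  then have "hc m (c - d) = T (g - f)" using T_hc[of m "c - d"] by simp
  also have "\<dots> \<in> Sp (int m)" using f g by (intro Lz_mem) simp
  finally have "hc m (c - d) \<in> Sp (int m - 1)" by (rule Sp_mem) simp
  then have "c = d" using hc_m_regular by fastforce
  then show ?thesis using * ab by simp
qed

lemma B_decomp_unique:
  assumes "B_decomp X x f c a" "B_decomp X x g d b" shows "f = g \<and> c = d \<and> a = b"
  by (rule decomp_unique) (use assms in \<open>auto simp: B_decomp_def\<close>)

lemma Gamma0_eq: "B_decomp X x f c a \<Longrightarrow> Gamma0 X x = c"
  unfolding Gamma0_def using B_decomp_unique by blast

lemma Gamma1_eq:
  assumes "B_decomp X x f c a" shows "Gamma1 X x = phi_vec X f - gram_min X *v a"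
  unfolding Gamma1_def
  by (rule the_equality) (use assms B_decomp_unique in blast)+

text \<open>The component of u' - z u = g in \<open>K\<^sub>A X\<close> merely fixes the summand
  from \<open>H\<^sub>A_perp X\<close>, as z h_m(a) minus the part coming from \<open>A_max\<close>.
  What is left is that this vector has vanishing \<open>gram_row\<close>, and this is the last
  equation, into which M_d enters through \<open>Delta\<close>.\<close>

lemma shifted_decomp_iff:
  assumes g: "g \<in> Sp (int m)"
  shows "(\<exists>u'. B_decomp X (u, u') f c a \<and> u' - scl X z u = g) \<longleftrightarrow>
    f \<in> Sp (int m + 2) \<and> u = f + hc (Suc m) c + hc m a \<and>
    Lz z f = g + scl X (z - z1) (hc (Suc m) c) \<and>
    gram_min X *v c = z *s (gram_min X *v a) - Delta X *v a" (is "?L \<longleftrightarrow> ?R")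
proof
  assume ?L
  then obtain u' k' k where f: "f \<in> Sp (int m + 2)" and u: "u = f + hc (Suc m) c + hc m a"
    and k': "k' \<in> K\<^sub>A X" and k: "k \<in> H\<^sub>A_perp X"
    and co: "\<forall>p\<in>I. coord X k' p = Md_apply X (eta X a) p + eta X c p"
    and u': "u' = opL X f + scl X z1 (hc (Suc m) c) + k' + k" and eq: "u' - scl X z u = g"
    unfolding B_decomp_def by auto
  obtain b where b: "k = comb b" "gram_row b = 0" using k H_A_perp_iff by blast
  obtain b' where b': "k' = comb b'" using k' K_A_iff by blast
  have "(Lz z f - scl X (z - z1) (hc (Suc m) c)) + comb (\<lambda>p. b' p + b p - z * eta X a p) = g + 0"
    unfolding comb_diff comb_add comb_scl comb_eta eq[symmetric] u' u b' b(1) Lz_def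
    by (simp add: scale_right_distrib scale_left_diff_distrib)
  then have *: "Lz z f - scl X (z - z1) (hc (Suc m) c) = g \<and> comb (\<lambda>p. b' p + b p - z * eta X a p) = 0"
    using Lz_mem[OF f, of z] g subspace_0[OF subspace_K_A] by (intro direct_sum) simp_all
  have "b p = z * eta X a p - (Md_apply X (eta X a) p + eta X c p)" if p: "p \<in> I" for p
    using comb_eq_0[OF conjunct2[OF *] p] co p by (simp add: b' coord_comb algebra_simps)
  then have "gram_row b = gram_row (\<lambda>p. z * eta X a p - (Md_apply X (eta X a) p + eta X c p))"
    by (rule gram_row_cong)
  then have "z *s (gram_min X *v a) - (Delta X *v a + gram_min X *v c) = 0"
    using b(2) by (simp add: gram_row_diff gram_row_add gram_row_scl gram_row_eta gram_row_Md_eta)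
  then show ?R using f u * by (simp add: algebra_simps)
next
  assume R: ?R
  define b' where "b' p = Md_apply X (eta X a) p + eta X c p" for p
  define b where "b p = z * eta X a p - b' p" for p
  define u' where "u' = opL X f + scl X z1 (hc (Suc m) c) + comb b' + comb b"
  have "gram_row b = 0"
    unfolding b_def b'_def using R
    by (simp add: gram_row_diff gram_row_add gram_row_scl gram_row_eta gram_row_Md_eta)
  then have "comb b \<in> H\<^sub>A_perp X" using H_A_perp_iff by blast
  then have "B_decomp X (u, u') f c a"
    unfolding B_decomp_def using R
    by (intro conjI bexI[OF bexI[OF _ \<open>comb b \<in> H\<^sub>A_perp X\<close>] comb_mem[of b']])
      (simp_all add: coord_comb b'_def u'_def)
  moreover have "u' - scl X z u = g"
  proof -
    have "comb b = scl X z (hc m a) - comb b'" unfolding b_def comb_diff comb_scl comb_eta ..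
    then have "u' - scl X z u = Lz z f - scl X (z - z1) (hc (Suc m) c)"
      unfolding u'_def Lz_def using R by (simp add: scale_right_distrib scale_left_diff_distrib)
    then show ?thesis using R by simp
  qed
  ultimately show ?L by blast
qed

end

section \<open>The compressed resolvent\<close>

lemma shifted_inverse_iff: "(g, u) \<in> shifted_inverse M R \<longleftrightarrow> (\<exists>u'. (u, u') \<in> R \<and> u' - M u = g)"
  by (auto simp: shifted_inverse_def)

lemma invertible_if_positive_definite:
  assumes "positive_definite A" shows "invertible A"
proof -
  have "c = 0" if "A *v c = 0" for c
  proof (rule ccontr)
    assume "c \<noteq> 0"
    then have "0 < Re (\<Sum>i\<in>UNIV. cnj (c $ i) * (A *v c) $ i)"
      using assms by (simp add: positive_definite_def)
    then show False using that by simp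
  qed
  then show ?thesis using matrix_left_invertible_ker[of A] invertible_left_inverse by blast
qed

lemma matrix_inv_mult_vec:
  fixes A :: "'i::finite cmat"
  assumes "invertible A"
  shows "matrix_inv A *v (A *v x) = x" "A *v (matrix_inv A *v x) = x"
proof -
  have "A ** matrix_inv A = mat 1 \<and> matrix_inv A ** A = mat 1"
    using assms unfolding matrix_inv_def invertible_def by (rule someI_ex)
  then show "matrix_inv A *v (A *v x) = x" "A *v (matrix_inv A *v x) = x"
    by (simp_all add: matrix_vector_mul_assoc)
qed

context peak
begin

section \<open>The relations B_0 and B_Theta in coordinates, and what a point of res B_0
  provides\<close>

lemma B_zero_iff: "x \<in> B_zero X \<longleftrightarrow> (\<exists>f a. B_decomp X x f 0 a)"
proof
  assume "x \<in> B_zero X"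
  then obtain f c a where "B_decomp X x f c a" "Gamma0 X x = 0"
    using B_max_iff[of x] by (auto simp: B_zero_def)
  then show "\<exists>f a. B_decomp X x f 0 a" using Gamma0_eq by metis
next
  assume "\<exists>f a. B_decomp X x f 0 a"
  then obtain f a where x: "B_decomp X x f 0 a" by blast
  then have "x \<in> B_max X" using B_max_iff by blast
  then show "x \<in> B_zero X" using Gamma0_eq[OF x] by (simp add: B_zero_def)
qed

lemma B_Theta_iff:
  "x \<in> B_Theta X \<Theta> \<longleftrightarrow> (\<exists>f c a. B_decomp X x f c a \<and> (c, phi_vec X f - gram_min X *v a) \<in> \<Theta>)"
proof
  assume "x \<in> B_Theta X \<Theta>"
  then obtain f c a where "B_decomp X x f c a" "(Gamma0 X x, Gamma1 X x) \<in> \<Theta>"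
    using B_max_iff[of x] by (auto simp: B_Theta_def)
  then show "\<exists>f c a. B_decomp X x f c a \<and> (c, phi_vec X f - gram_min X *v a) \<in> \<Theta>"
    using Gamma0_eq Gamma1_eq by metis
next
  assume "\<exists>f c a. B_decomp X x f c a \<and> (c, phi_vec X f - gram_min X *v a) \<in> \<Theta>"
  then obtain f c a where x: "B_decomp X x f c a" "(c, phi_vec X f - gram_min X *v a) \<in> \<Theta>" by blast
  then have "x \<in> B_max X" using B_max_iff by blast
  then show "x \<in> B_Theta X \<Theta>" using x Gamma0_eq[OF x(1)] Gamma1_eq[OF x(1)] by (simp add: B_Theta_def)
qed

text \<open>For c = 0 the equations for \<open>f\<close> and for \<open>a\<close> decouple.\<close>

lemma B_zero_resolvent_iff:
  assumes "g \<in> Sp (int m)"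
  shows "(g, u) \<in> shifted_inverse (scl X z) (B_zero X) \<longleftrightarrow>
    (\<exists>f a. f \<in> Sp (int m + 2) \<and> u = f + hc m a \<and> Lz z f = g \<and>
      z *s (gram_min X *v a) = Delta X *v a)"
proof -
  have "(g, u) \<in> shifted_inverse (scl X z) (B_zero X) \<longleftrightarrow>
      (\<exists>f a u'. B_decomp X (u, u') f 0 a \<and> u' - scl X z u = g)"
    by (auto simp: shifted_inverse_iff B_zero_iff)
  also have "\<dots> \<longleftrightarrow> (\<exists>f a. f \<in> Sp (int m + 2) \<and> u = f + hc m a \<and> Lz z f = g \<and>
      z *s (gram_min X *v a) = Delta X *v a)"
    unfolding shifted_decomp_iff[OF assms] by (auto simp: eq_commute[of 0])
  finally show ?thesis .
qed

lemma Delta_hat_shift: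
  assumes "invertible (gram_min X)"
  shows "gram_min X *v ((Delta_hat X - mat z) *v a) = Delta X *v a - z *s (gram_min X *v a)"
proof -
  have "gram_min X *v (Delta_hat X *v a) = Delta X *v a"
    unfolding Delta_hat_def matrix_vector_mul_assoc[symmetric] by (rule matrix_inv_mult_vec(2)[OF assms])
  moreover have "mat z *v a = z *s a"
    by (simp add: vec_eq_iff matrix_vector_mult_def mat_def if_distrib[of "\<lambda>x. x * _"] cong: if_cong)
  moreover have "gram_min X *v (z *s a) = z *s (gram_min X *v a)"
    by (simp add: vec_eq_iff matrix_vector_mult_def sum_distrib_left algebra_simps)
  ultimately show ?thesis
    by (simp add: matrix_vector_mult_diff_rdistrib matrix_vector_mult_diff_distrib)
qed

text \<open>Single-valuedness at 0 excludes a kernel in each of the decoupled equations. The full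
  domain gives surjectivity of L - z onto \<open>Sp m\<close>; for the square matrix, injectivity is
  enough.\<close>

lemma res_B_zero:
  assumes z: "z \<in> res\<^sub>A X (B_zero X)" and G: "invertible (gram_min X)"
  shows "scale_res X z (int m)" "invertible (Delta_hat X - mat z)"
proof -
  let ?R = "shifted_inverse (scl X z) (B_zero X)"
  have sv: "single_valued ?R" and dom: "Domain ?R = H\<^sub>A X"
    using z by (auto simp: res\<^sub>A_def resolvent_set_def)
  have zero: "(0, 0) \<in> ?R"
    unfolding B_zero_resolvent_iff[OF H.mem_0] by (intro exI[of _ 0]) simp
  have unique: "u = 0" if "(0, u) \<in> ?R" for u
    using single_valuedD[OF sv that zero] .
  show "scale_res X z (int m)"
  proof unfold_locales
    fix u assume u: "u \<in> Sp (int m)" "Lz z u = 0"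
    then have "u \<in> Sp (int m + 2)" using Lz_regularity[of u "int m" z "int m"] by simp
    then have "(0, u) \<in> ?R"
      unfolding B_zero_resolvent_iff[OF H.mem_0] using u(2) by (intro exI[of _ u] exI[of _ 0]) simp
    then show "u = 0" by (rule unique)
  next
    fix f assume f: "f \<in> Sp (int m)"
    then have "f \<in> H\<^sub>A X"
      unfolding H\<^sub>A_def using subspace_0[OF subspace_K_A] by (intro CollectI exI[of _ f] exI[of _ 0]) simp
    then obtain u where "(f, u) \<in> ?R" using dom by blast
    then show "\<exists>u\<in>Sp (int m + 2). Lz z u = f" using B_zero_resolvent_iff[OF f] by blast
  qed
  have "a = 0" if "(Delta_hat X - mat z) *v a = 0" for a
  proof -
    have "z *s (gram_min X *v a) = Delta X *v a"
      using Delta_hat_shift[OF G, of z a] that by simp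
    then have "(0, hc m a) \<in> ?R"
      unfolding B_zero_resolvent_iff[OF H.mem_0] by (intro exI[of _ 0] exI[of _ a]) simp
    then have "hc m a = 0" by (rule unique)
    then show ?thesis by (rule hc_eq_0)
  qed
  then show "invertible (Delta_hat X - mat z)"
    using matrix_left_invertible_ker[of "Delta_hat X - mat z"] invertible_left_inverse by blast
qed

lemma phi_vec_add:
  assumes "f \<in> Sp (int m + 2)" "g \<in> Sp (int m + 2)"
  shows "phi_vec X (f + g) = phi_vec X f + phi_vec X g"
  using pairing_add[of "m + 2" _ f g] func_mem assms
  by (simp add: phi_vec_def vec_eq_iff add.commute)

end

section \<open>Solving the resolvent equation at a point of res B_0\<close>

locale peak_res = peak X + scale_res X z "int (ord\<^sub>m X)"
  for X :: "('v::ab_group_add, 'i::finite) peak_data" and z +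
  assumes gram_inv: "invertible (gram_min X)"
    and Delta_inv: "invertible (Delta_hat X - mat z)"
begin

definition D :: "'i cvec \<Rightarrow> 'i cvec" where "D c = matrix_inv (Delta_hat X - mat z) *v c"

text \<open>The right hand side is -G^min (hat Delta - z) a, so that G^min cancels; hence the minus
  sign in \<open>sol\<close>.\<close>

lemma gram_Delta_iff:
  "gram_min X *v c = z *s (gram_min X *v a) - Delta X *v a \<longleftrightarrow> a = - D c"
proof -
  let ?E = "Delta_hat X - mat z"
  have "gram_min X *v c = z *s (gram_min X *v a) - Delta X *v a \<longleftrightarrow>
      gram_min X *v c = gram_min X *v (- (?E *v a))"
    using Delta_hat_shift[OF gram_inv, of z a] matrix_vector_mult_diff_distrib[of "gram_min X" 0 "?E *v a"]
    by simp
  also have "\<dots> \<longleftrightarrow> c = - (?E *v a)"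
    using matrix_inv_mult_vec(1)[OF gram_inv] by metis
  also have "\<dots> \<longleftrightarrow> ?E *v a = - c" by (metis minus_minus)
  also have "\<dots> \<longleftrightarrow> a = matrix_inv ?E *v (- c)"
    using matrix_inv_mult_vec[OF Delta_inv] by metis
  also have "matrix_inv ?E *v (- c) = - D c"
    using matrix_vector_mult_diff_distrib[of "matrix_inv ?E" 0 c] by (simp add: D_def)
  finally show ?thesis .
qed

text \<open>The regular part f# belonging to a given \<open>c\<close>, which stays free until the
  boundary condition is imposed.\<close>

definition reg :: "'v \<Rightarrow> 'i cvec \<Rightarrow> 'v" where
  "reg g c = Lres X z g + scl X (z - z1) (Lres X z (hc (Suc m) c))"

definition sol :: "'v \<Rightarrow> 'i cvec \<Rightarrow> 'v" where
  "sol g c = reg g c + hc (Suc m) c + hc m (- D c)"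

lemma reg_mem: "g \<in> Sp (int m) \<Longrightarrow> reg g c \<in> Sp (int m + 2)"
  by (simp add: reg_def Lres_props)

lemma reg_iff:
  assumes g: "g \<in> Sp (int m)"
  shows "f \<in> Sp (int m + 2) \<and> Lz z f = g + scl X (z - z1) (hc (Suc m) c) \<longleftrightarrow> f = reg g c"
proof
  assume f: "f \<in> Sp (int m + 2) \<and> Lz z f = g + scl X (z - z1) (hc (Suc m) c)"
  then have "Lres X z (g + scl X (z - z1) (hc (Suc m) c)) = f" by (intro Lres_eqI) auto
  then show "f = reg g c"
    using Lres_add[OF g, of "scl X (z - z1) (hc (Suc m) c)"] Lres_scl[OF hc_Suc_m_mem]
    by (simp add: reg_def)
qed (use g reg_mem Lres_props(2)[OF g] Lres_props(2)[OF hc_Suc_m_mem] in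
    \<open>auto simp: reg_def Lz_add Lz_scl\<close>)

lemma sol_inj: "g \<in> Sp (int m) \<Longrightarrow> sol g c = sol g d \<Longrightarrow> c = d"
  using decomp_unique[OF _ reg_mem reg_mem] by (auto simp: sol_def)

text \<open>The Krein Q-function arises as the boundary value of (z - z_1) (L - z)^(-1) h_(m+1)(c),
  the part of \<open>reg g c\<close> that depends on \<open>c\<close>.\<close>

lemma phi_vec_reg:
  assumes g: "g \<in> Sp (int m)"
  shows "phi_vec X (reg g c) = phi_vec X (Lres X z g) + Krein_Q X z *v c"
proof -
  let ?R = "\<lambda>\<sigma>. Lres X z (h \<sigma> (Suc m))"
  have hm: "h \<sigma> (Suc m) \<in> Sp (int m)" for \<sigma> using h_mem[of \<sigma> "Suc m"] by simp
  have Rm: "?R \<sigma> \<in> Sp (int m + 2)" for \<sigma> using Lres_props(1)[OF hm] .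
  have n: "int m + 2 = int (m + 2)" "- int m - 2 = - int (m + 2)" by simp_all
  have "Lres X z (hc (Suc m) c) = (\<Sum>\<sigma>\<in>UNIV. scl X (c $ \<sigma>) (?R \<sigma>))"
    unfolding hcomb_def using hm by (subst Lres_sum[of _ _ "int m"]) (simp_all add: Lres_scl[OF hm])
  then have eq: "scl X (z - z1) (Lres X z (hc (Suc m) c)) = (\<Sum>\<sigma>\<in>UNIV. scl X ((z - z1) * c $ \<sigma>) (?R \<sigma>))"
    by (simp add: scale_sum_right)
  have "phi_vec X (scl X (z - z1) (Lres X z (hc (Suc m) c))) = Krein_Q X z *v c"
  proof (unfold eq vec_eq_iff, rule allI)
    fix \<sigma>
    have "phi_vec X (\<Sum>\<sigma>'\<in>UNIV. scl X ((z - z1) * c $ \<sigma>') (?R \<sigma>')) $ \<sigma> =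
        (\<Sum>\<sigma>'\<in>UNIV. pairing X (int (m + 2)) (func X \<sigma>) (scl X ((z - z1) * c $ \<sigma>') (?R \<sigma>')))"
      unfolding phi_vec_def vec_lambda_beta n(1)
      by (rule pairing_sum) (use func_mem[of \<sigma>] Rm in \<open>simp_all add: n\<close>)
    also have "\<dots> = (\<Sum>\<sigma>'\<in>UNIV. (z - z1) * c $ \<sigma>' * pairing X (int (m + 2)) (func X \<sigma>) (?R \<sigma>'))"
      by (intro sum.cong refl pairing_scl) (use func_mem[of \<sigma>] Rm in \<open>simp_all add: n\<close>)
    also have "\<dots> = (Krein_Q X z *v c) $ \<sigma>"
      by (simp add: Krein_Q_def matrix_vector_mult_def algebra_simps)
    finally show "phi_vec X (\<Sum>\<sigma>'\<in>UNIV. scl X ((z - z1) * c $ \<sigma>') (?R \<sigma>')) $ \<sigma> = (Krein_Q X z *v c) $ \<sigma>" .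
  qed
  then show ?thesis
    unfolding reg_def using Lres_props(1)[OF g] Lres_props(1)[OF hc_Suc_m_mem]
    by (subst phi_vec_add) simp_all
qed

lemma Weyl_M_mult_vec: "Weyl_M X z *v c = Krein_Q X z *v c + gram_min X *v D c"
  by (simp add: Weyl_M_def D_def matrix_vector_mul_assoc matrix_vector_mult_add_rdistrib)

text \<open>With a = -D c, the term -G^min a of the boundary map becomes +G^min D c, the second
  summand of M(z) c; the first comes from \<open>phi_vec_reg\<close>. Membership of (c, <phi, (L -
  z)^(-1) g> + M(z) c) in Theta is then membership in a shifted inverse.\<close>

lemma resolvent_B_Theta_iff:
  assumes g: "g \<in> Sp (int m)"
  shows "(g, u) \<in> shifted_inverse (scl X z) (B_Theta X \<Theta>) \<longleftrightarrow>
    (\<exists>c. (phi_vec X (Lres X z g), c) \<in> shifted_inverse ((*v) (Weyl_M X z)) \<Theta> \<and> u = sol g c)"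
proof -
  have "(g, u) \<in> shifted_inverse (scl X z) (B_Theta X \<Theta>) \<longleftrightarrow>
      (\<exists>f c a. (\<exists>u'. B_decomp X (u, u') f c a \<and> u' - scl X z u = g) \<and>
        (c, phi_vec X f - gram_min X *v a) \<in> \<Theta>)"
    by (auto simp: shifted_inverse_iff B_Theta_iff)
  also have "\<dots> \<longleftrightarrow> (\<exists>f c a. f = reg g c \<and> a = - D c \<and> u = f + hc (Suc m) c + hc m a \<and>
        (c, phi_vec X f - gram_min X *v a) \<in> \<Theta>)"
    unfolding shifted_decomp_iff[OF g] gram_Delta_iff reg_iff[OF g, symmetric] by blast
  also have "\<dots> \<longleftrightarrow> (\<exists>c. (c, phi_vec X (reg g c) - gram_min X *v (- D c)) \<in> \<Theta> \<and> u = sol g c)"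
    unfolding sol_def by blast
  also have "\<dots> \<longleftrightarrow> (\<exists>c. (c, phi_vec X (Lres X z g) + Weyl_M X z *v c) \<in> \<Theta> \<and> u = sol g c)"
  proof -
    have "gram_min X *v (- D c) = - (gram_min X *v D c)" for c
      using matrix_vector_mult_diff_distrib[of "gram_min X" 0 "D c"] by simp
    then show ?thesis by (simp add: phi_vec_reg[OF g] Weyl_M_mult_vec add.assoc)
  qed
  also have "\<dots> \<longleftrightarrow> (\<exists>c. (phi_vec X (Lres X z g), c) \<in> shifted_inverse ((*v) (Weyl_M X z)) \<Theta> \<and> u = sol g c)"
    unfolding shifted_inverse_iff by (metis add_diff_cancel diff_add_cancel)
  finally show ?thesis .
qed

text \<open>When L - z is applied to the sum of \<open>reg g c\<close> and h_(m+1)(c), the terms (z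
  - z_1) h_(m+1)(c) cancel and T h_(m+1)(c) = h_m(c) remains. So h_(m+1) disappears from the
  compressed formula.\<close>

lemma projH_sol:
  assumes g: "g \<in> Sp (int m)"
  shows "projH X (sol g c) = Lres X z g + (\<Sum>\<sigma>\<in>UNIV. scl X (c $ \<sigma>) (Lres X z (h \<sigma> m)))"
proof -
  have f: "reg g c + hc (Suc m) c \<in> Sp (int m)"
    using Sp_m2_in_Sp_m[OF reg_mem[OF g]] by simp
  have "Lz z (reg g c + hc (Suc m) c) = g + hc m c"
  proof -
    have "Lz z (reg g c) = g + scl X (z - z1) (hc (Suc m) c)" using reg_iff[OF g, of "reg g c" c] by simp
    then show ?thesis by (simp add: Lz_add Lz_shift[of z "hc (Suc m) c"] T_hc)
  qed
  then have "reg g c + hc (Suc m) c = Lres X z (g + hc m c)" using Lres_eqI[OF f] by simp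
  \<comment> \<open>\<open>hc m c\<close> is of order m-2 only, so both summands are viewed in
    \<open>Sp (m - 2)\<close>.\<close>
  also have "\<dots> = Lres X z g + Lres X z (hc m c)"
    using Sp_mem[OF g, of "int m - 2"] hc_mem[of m c] by (intro Lres_add[of _ "int m - 2"]) simp_all
  also have "Lres X z (hc m c) = (\<Sum>\<sigma>\<in>UNIV. scl X (c $ \<sigma>) (Lres X z (h \<sigma> m)))"
    unfolding hcomb_def using h_mem[of _ m]
    by (subst Lres_sum[of _ _ "int m - 2"]) (simp_all add: Lres_scl[of _ "int m - 2"])
  finally show ?thesis using projH_eq[OF f hc_m_mem] by (simp add: sol_def)
qed

end

text \<open>The generalized sense is an equality of graphs: (Theta - M(z))^(-1) is a relation, and
  \<open>c\<close> ranges over its values at <phi, (L - z)^(-1) f>. The first conjunct adds that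
  there is exactly one such value.\<close>

theorem mainTheorem4:
  fixes X :: "('v::ab_group_add, 'i::finite) peak_data"
    and \<Theta> :: "'i cvec rel"
    and z :: complex
  assumes "peak_model X"
    and "gram_invertible X" and "gram_hermitian X"
    and "2 \<le> ord\<^sub>m X \<Longrightarrow>
           \<forall>\<sigma> \<sigma>'. gram X (\<sigma>, ord\<^sub>m X - 1) (\<sigma>', ord\<^sub>m X) = gram X (\<sigma>, ord\<^sub>m X) (\<sigma>', ord\<^sub>m X - 1)"
    and "positive_definite (gram_min X)"
    and "linear_relation \<Theta>"
    and "z \<in> res\<^sub>A X (B_zero X) \<inter> res\<^sub>A X (B_Theta X \<Theta>)"
  shows "(\<forall>f\<in>space\<^sub>H X (int (ord\<^sub>m X)).
            \<exists>!c. (phi_vec X (Lres X z f), c) \<in> shifted_inverse ((*v) (Weyl_M X z)) \<Theta>) \<and>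
         {(f, projH X u) | f u.
            f \<in> space\<^sub>H X (int (ord\<^sub>m X)) \<and> (f, u) \<in> shifted_inverse (scl X z) (B_Theta X \<Theta>)} =
         {(f, Lres X z f + (\<Sum>\<sigma>\<in>UNIV. scl X (c $ \<sigma>) (Lres X z (hvec X \<sigma> (ord\<^sub>m X))))) | f c.
            f \<in> space\<^sub>H X (int (ord\<^sub>m X)) \<and>
            (phi_vec X (Lres X z f), c) \<in> shifted_inverse ((*v) (Weyl_M X z)) \<Theta>}"
proof -
  interpret peak X using assms(1) by unfold_locales
  have G: "invertible (gram_min X)" using assms(5) by (rule invertible_if_positive_definite)
  have z: "z \<in> res\<^sub>A X (B_zero X)" "z \<in> res\<^sub>A X (B_Theta X \<Theta>)" using assms(7) by auto
  interpret scale_res X z "int m" using z(1) G by (rule res_B_zero)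
  interpret peak_res X z using G res_B_zero(2)[OF z(1) G] by unfold_locales
  let ?S = "shifted_inverse ((*v) (Weyl_M X z)) \<Theta>" and ?R = "shifted_inverse (scl X z) (B_Theta X \<Theta>)"
  have sv: "single_valued ?R" and dom: "Domain ?R = H\<^sub>A X"
    using z(2) by (auto simp: res\<^sub>A_def resolvent_set_def)
  have uniq: "\<exists>!c. (phi_vec X (Lres X z f), c) \<in> ?S" if f: "f \<in> Sp (int m)" for f
  proof -
    have "f \<in> H\<^sub>A X"
      unfolding H\<^sub>A_def using f subspace_0[OF subspace_K_A] by (intro CollectI exI[of _ f] exI[of _ 0]) simp
    then have "\<exists>u. (f, u) \<in> ?R" using dom by blast
    then have "\<exists>c. (phi_vec X (Lres X z f), c) \<in> ?S" using resolvent_B_Theta_iff[OF f] by blast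
    \<comment> \<open>\<open>sol f\<close> is injective, so two values of \<open>c\<close> would
      give two images of \<open>f\<close> under the single-valued resolvent.\<close>
    moreover have "c = d" if "(phi_vec X (Lres X z f), c) \<in> ?S" "(phi_vec X (Lres X z f), d) \<in> ?S" for c d
    proof -
      have "(f, sol f c) \<in> ?R" "(f, sol f d) \<in> ?R" using that resolvent_B_Theta_iff[OF f] by blast+
      then show ?thesis using sol_inj[OF f] single_valuedD[OF sv] by blast
    qed
    ultimately show ?thesis by blast
  qed
  have "{(f, projH X u) | f u. f \<in> Sp (int m) \<and> (f, u) \<in> ?R} =
      {(f, projH X (sol f c)) | f c. f \<in> Sp (int m) \<and> (phi_vec X (Lres X z f), c) \<in> ?S}"
  proof -
    have "f \<in> Sp (int m) \<and> (f, u) \<in> ?R \<longleftrightarrow>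
        f \<in> Sp (int m) \<and> (\<exists>c. (phi_vec X (Lres X z f), c) \<in> ?S \<and> u = sol f c)" for f u
      using resolvent_B_Theta_iff by metis
    then show ?thesis by auto
  qed
  also have "\<dots> = {(f, Lres X z f + (\<Sum>\<sigma>\<in>UNIV. scl X (c $ \<sigma>) (Lres X z (h \<sigma> m)))) | f c.
      f \<in> Sp (int m) \<and> (phi_vec X (Lres X z f), c) \<in> ?S}"
    by (intro Collect_cong ex_cong1) (auto simp: projH_sol)
  finally show ?thesis using uniq by blast
qed

end
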